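(* Let $(\mathfrak A[\|\cdot\|_{\mathfrak A}],\mathfrak A_0)$ and $(\mathfrak B[\|\cdot\|_{\mathfrak B}],\mathfrak B_0)$ be (unital) Banach quasi *-algebras and let $\bar n$ be a uniform cross-norm on $\mathfrak A\otimes\mathfrak B$. If $(\mathfrak A\otimes_{\bar n}\mathfrak B,\mathfrak A_0\otimes\mathfrak B_0)$ is fully representable, then $(\mathfrak A[\|\cdot\|_{\mathfrak A}],\mathfrak A_0)$ and $(\mathfrak B[\|\cdot\|_{\mathfrak B}],\mathfrak B_0)$ are fully representable too.
   Context: All vector spaces are complex. A quasi *-algebra $(\mathfrak A,\mathfrak A_0)$ is a vector space $\mathfrak A$ with a *-algebra $\mathfrak A_0\subseteq\mathfrak A$ (as a subspace) such that: (i) products $ax$, $xa$ ($a\in\mathfrak A$, $x\in\mathfrak A_0$) are defined in $\mathfrak A$ and bilinear, extending the multiplication of $\mathfrak A_0$; (ii) $(xa)y=x(ay)$, $a(xy)=(ax)y$ for $x,y\in\mathfrak A_0$, $a\in\mathfrak A$; (iii) $\mathfrak A$ has an involution extending that of $\mathfrak A_0$ with $(ax)^*=x^*a^*$, $(xa)^*=a^*x^*$. It is unital if there is $e\in\mathfrak A_0$ with $ae=a=ea$ for all $a\in\mathfrak A$. It is a normed (Banach) quasi *-algebra if $\mathfrak A$ carries a (complete) norm with $\|a^*\|=\|a\|$, $\mathfrak A_0$ dense in $\mathfrak A$, and $a\mapsto ax$ continuous for every $x\in\mathfrak A_0$. Standing convention: quasi *-algebras are unital, with units of norm $1$. $\mathfrak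 A\otimes\mathfrak B$ is a quasi *-algebra over $\mathfrak A_0\otimes\mathfrak B_0$ via $(a\otimes b)(x\otimes y)=ax\otimes by$, $(x\otimes y)(a\otimes b)=xa\otimes yb$, $(a\otimes b)^*=a^*\otimes b^*$. A cross-norm $\bar n$ on $\mathfrak A\otimes\mathfrak B$ is a norm with $\|a\otimes b\|_{\bar n}=\|a\|_{\mathfrak A}\|b\|_{\mathfrak B}$; it is uniform if for all bounded linear $T_1:\mathfrak A\to\mathfrak A$, $T_2:\mathfrak B\to\mathfrak B$ the operator $T_1\otimes T_2$ is $\bar n$-bounded and its extension to the completion has norm $\le\|T_1\|\|T_2\|$. $\mathfrak A\otimes_{\bar n}\mathfrak B$ denotes $\mathfrak A\otimes\mathfrak B$ with the norm $\bar n$; it is understood that the involution is $\bar n$-isometric, so that it is a normed quasi *-algebra over $\mathfrak A_0\otimes\mathfrak B_0$. A linear functional $\omega$ on $\mathfrak A$ is representable if: (L.1) $\omega(x^*x)\ge0$ for all $x\in\mathfrak A_0$; (L.2) $\omega(y^*a^*x)=\overline{\omega(x^*ay)}$ for all $x,y\in\mathfrak A_0$, $a\in\mathfrak A$; (L.3) for all $a\in\mathfrak A$ there is $\gamma_a>0$ with $|\omega(a^*x)|\le\gamma_a\,\omega(x^*x)^{1/2}$ for all $x\in\mathfrak A_0$. For a normed quasi *-algebra, $\mathcal R_c(\mathfrak A,\mathfrak A_0)$ denotes the set of continuous representable linear functionals. For $\omega\in\mathcal R_c(\mathfrak A,\mathfrak A_0)$ put $\varphi_\omega(x,y)=\omega(y^*x)$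 on $\mathfrak A_0\times\mathfrak A_0$; this form is closable and its closure $\overline\varphi_\omega$ has domain $\mathcal D(\overline\varphi_\omega)=\{a\in\mathfrak A:\exists\{x_n\}\subset\mathfrak A_0,\ \|x_n-a\|\to0,\ \varphi_\omega(x_n-x_m,x_n-x_m)\to0\}$. Put $\mathfrak A_{\mathcal R}=\bigcap_{\omega\in\mathcal R_c(\mathfrak A,\mathfrak A_0)}\mathcal D(\overline\varphi_\omega)$ ($=\mathfrak A$ if $\mathcal R_c(\mathfrak A,\mathfrak A_0)=\{0\}$). Let $\mathfrak A^+$ be the norm closure in $\mathfrak A$ of $\{\sum_{k=1}^n x_k^*x_k: x_k\in\mathfrak A_0,\ n\in\mathbb N\}$. $\mathcal R_c(\mathfrak A,\mathfrak A_0)$ is sufficient if for every $0\ne a\in\mathfrak A^+$ there is $\omega\in\mathcal R_c(\mathfrak A,\mathfrak A_0)$ with $\omega(a)>0$. $(\mathfrak A,\mathfrak A_0)$ is fully representable if $\mathcal R_c(\mathfrak A,\mathfrak A_0)$ is sufficient and $\mathfrak A_{\mathcal R}=\mathfrak A$. *)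

theory Defs
  imports "HOL-Analysis.Analysis" "HOL-Library.Poly_Mapping" "HOL-Library.Complex_Order"
begin

section \<open>Complex vector spaces and norms\<close>

class complex_vector = ab_group_add +
  fixes scaleC :: "complex \<Rightarrow> 'a \<Rightarrow> 'a" (infixr \<open>*\<^sub>C\<close> 75)
  assumes scaleC_add_right: "c *\<^sub>C (x + y) = c *\<^sub>C x + c *\<^sub>C y"
    and scaleC_add_left: "(c + d) *\<^sub>C x = c *\<^sub>C x + d *\<^sub>C x"
    and scaleC_scaleC: "c *\<^sub>C d *\<^sub>C x = (c * d) *\<^sub>C x"
    and scaleC_one: "1 *\<^sub>C x = x"

global_interpretation cvs: vector_space "scaleC :: complex \<Rightarrow> 'a \<Rightarrow> 'a::complex_vector"
  by unfold_locales (fact scaleC_add_right scaleC_add_left scaleC_scaleC scaleC_one)+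

abbreviation clinear :: "('a::complex_vector \<Rightarrow> 'b::complex_vector) \<Rightarrow> bool"
  where "clinear \<equiv> Vector_Spaces.linear scaleC scaleC"

abbreviation linear_functional :: "('a::complex_vector \<Rightarrow> complex) \<Rightarrow> bool"
  where "linear_functional \<equiv> Vector_Spaces.linear scaleC (*)"

definition antilinear :: "('a::complex_vector \<Rightarrow> 'b::complex_vector) \<Rightarrow> bool"
  where "antilinear f \<longleftrightarrow>
    (\<forall>x y. f (x + y) = f x + f y) \<and> (\<forall>c x. f (c *\<^sub>C x) = cnj c *\<^sub>C f x)"

text \<open>Norms are explicit functions and not class operations, since one tensor product space
  carries many different cross-norms.\<close>

definition is_norm :: "('a::complex_vector \<Rightarrow> real) \<Rightarrow> bool"
  where "is_norm n \<longleftrightarrow>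
    (\<forall>x. n x = 0 \<longleftrightarrow> x = 0) \<and>
    (\<forall>c x. n (c *\<^sub>C x) = cmod c * n x) \<and>
    (\<forall>x y. n (x + y) \<le> n x + n y)"

definition norm_topology :: "('a::complex_vector \<Rightarrow> real) \<Rightarrow> 'a topology"
  where "norm_topology n = Metric_space.mtopology UNIV (\<lambda>x y. n (x - y))"

definition norm_complete :: "('a::complex_vector \<Rightarrow> real) \<Rightarrow> bool"
  where "norm_complete n \<longleftrightarrow> Metric_space.mcomplete UNIV (\<lambda>x y. n (x - y))"

definition bounded_operator :: "('a::complex_vector \<Rightarrow> real) \<Rightarrow> ('a \<Rightarrow> 'a) \<Rightarrow> bool"
  where "bounded_operator n T \<longleftrightarrow> clinear T \<and> (\<exists>K. \<forall>x. n (T x) \<le> K * n x)"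

definition operator_norm :: "('a::complex_vector \<Rightarrow> real) \<Rightarrow> ('a \<Rightarrow> 'a) \<Rightarrow> real"
  where "operator_norm n T = (SUP x. n (T x) / n x)"

lemma is_norm_Metric_space:
  assumes "is_norm n"
  shows "Metric_space UNIV (\<lambda>x y. n (x - y))"
proof
  have zero: "n x = 0 \<longleftrightarrow> x = 0" and scale: "n (c *\<^sub>C x) = cmod c * n x"
    and tri: "n (x + y) \<le> n x + n y" for c x y
    using assms by (auto simp: is_norm_def)
  have minus: "n (- x) = n x" for x
    using scale[of "-1" x] by simp
  show "0 \<le> n (x - y)" for x y
    using tri[of "x - y" "- (x - y)"] minus[of "x - y"] zero[of 0] by simp
  show "n (x - y) = n (y - x)" for x y
    using minus[of "x - y"] by simp
  show "(n (x - y) = 0) = (x = y)" for x y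
    by (simp add: zero)
  show "n (x - z) \<le> n (x - y) + n (y - z)" for x y z
    using tri[of "x - y" "y - z"] by simp
qed

section \<open>The algebraic tensor product\<close>

text \<open>The quotient of the free complex vector space on pairs by the span of the bilinearity
  relations.\<close>

definition free_scale :: "complex \<Rightarrow> ('k \<Rightarrow>\<^sub>0 complex) \<Rightarrow> ('k \<Rightarrow>\<^sub>0 complex)"
  where "free_scale c = Poly_Mapping.map ((*) c)"

lemma lookup_free_scale [simp]:
  "Poly_Mapping.lookup (free_scale c f) k = c * Poly_Mapping.lookup f k"
  by (auto simp: free_scale_def Poly_Mapping.map.rep_eq when_def)

global_interpretation free_vs: vector_space free_scale
  by unfold_locales (auto intro!: poly_mapping_eqI simp: lookup_add algebra_simps)

abbreviation pair_generator :: "'a \<Rightarrow> 'b \<Rightarrow> ('a \<times> 'b) \<Rightarrow>\<^sub>0 complex"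
  where "pair_generator a b \<equiv> Poly_Mapping.single (a, b) 1"

definition bilinearity_relations :: "(('a::complex_vector \<times> 'b::complex_vector) \<Rightarrow>\<^sub>0 complex) set"
  where "bilinearity_relations =
    {pair_generator (a + a') b - pair_generator a b - pair_generator a' b | a a' b. True} \<union>
    {pair_generator a (b + b') - pair_generator a b - pair_generator a b' | a b b'. True} \<union>
    {pair_generator (c *\<^sub>C a) b - free_scale c (pair_generator a b) | c a b. True} \<union>
    {pair_generator a (c *\<^sub>C b) - free_scale c (pair_generator a b) | c a b. True}"

definition tensor_rel ::
    "(('a::complex_vector \<times> 'b::complex_vector) \<Rightarrow>\<^sub>0 complex) \<Rightarrow> (('a \<times> 'b) \<Rightarrow>\<^sub>0 complex) \<Rightarrow> bool"
  where "tensor_rel f g \<longleftrightarrow> f - g \<in> free_vs.span bilinearity_relations"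

quotient_type (overloaded) ('a, 'b) tensor =
  "('a::complex_vector \<times> 'b::complex_vector) \<Rightarrow>\<^sub>0 complex" / tensor_rel
proof (rule equivpI)
  show "reflp (tensor_rel :: (('a \<times> 'b) \<Rightarrow>\<^sub>0 complex) \<Rightarrow> _)"
    by (auto simp: reflp_def tensor_rel_def free_vs.span_zero)
  show "symp (tensor_rel :: (('a \<times> 'b) \<Rightarrow>\<^sub>0 complex) \<Rightarrow> _)"
    unfolding symp_def tensor_rel_def by (auto dest: free_vs.span_neg)
  show "transp (tensor_rel :: (('a \<times> 'b) \<Rightarrow>\<^sub>0 complex) \<Rightarrow> _)"
    unfolding transp_def tensor_rel_def by (auto dest: free_vs.span_add)
qed

instantiation tensor :: (complex_vector, complex_vector) complex_vector
begin

lift_definition zero_tensor :: "('a, 'b) tensor" is 0 .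

lift_definition plus_tensor :: "('a, 'b) tensor \<Rightarrow> ('a, 'b) tensor \<Rightarrow> ('a, 'b) tensor" is "(+)"
  unfolding tensor_rel_def by (auto dest: free_vs.span_add simp: add_diff_add)

lift_definition uminus_tensor :: "('a, 'b) tensor \<Rightarrow> ('a, 'b) tensor" is uminus
  unfolding tensor_rel_def by (auto dest: free_vs.span_neg simp: minus_diff_minus)

lift_definition minus_tensor :: "('a, 'b) tensor \<Rightarrow> ('a, 'b) tensor \<Rightarrow> ('a, 'b) tensor" is "(-)"
  unfolding tensor_rel_def by (drule (1) free_vs.span_diff) (simp add: algebra_simps)

lift_definition scaleC_tensor :: "complex \<Rightarrow> ('a, 'b) tensor \<Rightarrow> ('a, 'b) tensor" is free_scale
  unfolding tensor_rel_def by (drule free_vs.span_scale) (simp add: free_vs.scale_right_diff_distrib)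

instance
proof
  fix x y z :: "('a, 'b) tensor" and c d :: complex
  have refl: "tensor_rel f f" for f :: "('a \<times> 'b) \<Rightarrow>\<^sub>0 complex"
    by (simp add: tensor_rel_def free_vs.span_zero)
  show "x + y + z = x + (y + z)" by transfer (simp add: add.assoc refl)
  show "x + y = y + x" by transfer (simp add: add.commute refl)
  show "0 + x = x" by transfer (simp add: refl)
  show "- x + x = 0" by transfer (simp add: refl)
  show "x - y = x + - y" by transfer (simp add: refl)
  show "c *\<^sub>C (x + y) = c *\<^sub>C x + c *\<^sub>C y"
    by transfer (simp add: free_vs.scale_right_distrib refl)
  show "(c + d) *\<^sub>C x = c *\<^sub>C x + d *\<^sub>C x"
    by transfer (simp add: free_vs.scale_left_distrib refl)
  show "c *\<^sub>C d *\<^sub>C x = (c * d) *\<^sub>C x" by transfer (simp add: refl)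
  show "1 *\<^sub>C x = x" by transfer (simp add: refl)
qed

end

lift_definition tensor_of :: "'a::complex_vector \<Rightarrow> 'b::complex_vector \<Rightarrow> ('a, 'b) tensor"
    (infixr \<open>\<otimes>\<close> 72)
  is pair_generator .

lemma tensor_add_left: "(a + a') \<otimes> b = a \<otimes> b + a' \<otimes> b"
  and tensor_add_right: "a \<otimes> (b + b') = a \<otimes> b + a \<otimes> b'"
  and tensor_scale_left: "(c *\<^sub>C a) \<otimes> b = c *\<^sub>C (a \<otimes> b)"
  and tensor_scale_right: "a \<otimes> (c *\<^sub>C b) = c *\<^sub>C (a \<otimes> b)"
proof -
  note base = free_vs.span_base[of _ bilinearity_relations]
  show "(a + a') \<otimes> b = a \<otimes> b + a' \<otimes> b"
    by transfer (unfold tensor_rel_def diff_diff_eq[symmetric],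
        rule base, unfold bilinearity_relations_def, blast)
  show "a \<otimes> (b + b') = a \<otimes> b + a \<otimes> b'"
    by transfer (unfold tensor_rel_def diff_diff_eq[symmetric],
        rule base, unfold bilinearity_relations_def, blast)
  show "(c *\<^sub>C a) \<otimes> b = c *\<^sub>C (a \<otimes> b)"
    by transfer (unfold tensor_rel_def, rule base, unfold bilinearity_relations_def, blast)
  show "a \<otimes> (c *\<^sub>C b) = c *\<^sub>C (a \<otimes> b)"
    by transfer (unfold tensor_rel_def, rule base, unfold bilinearity_relations_def, blast)
qed

lemma tensor_induct [case_names add generator]:
  fixes t :: "('a::complex_vector, 'b::complex_vector) tensor"
  assumes add: "\<And>s t. P s \<Longrightarrow> P t \<Longrightarrow> P (s + t)"
    and gen: "\<And>a b. P (a \<otimes> b)"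
  shows "P t"
proof -
  have single: "P (abs_tensor (Poly_Mapping.single k c))" for k c
  proof -
    obtain a b where k: "k = (a, b)" by (cases k)
    have "Poly_Mapping.single k c = free_scale c (pair_generator a b)"
      by (auto intro!: poly_mapping_eqI simp: k lookup_single when_def)
    then have "abs_tensor (Poly_Mapping.single k c) = (c *\<^sub>C a) \<otimes> b"
      unfolding tensor_scale_left by (simp add: scaleC_tensor.abs_eq tensor_of.abs_eq)
    then show ?thesis by (simp add: gen)
  qed
  have "P (abs_tensor f)" for f
  proof (induction f rule: update_induct)
    case const
    show ?case using single[of undefined 0] by simp
  next
    case (update f k c)
    have "Poly_Mapping.update k c f = f + Poly_Mapping.single k c"
      using update
      by (intro poly_mapping_eqI)
        (auto simp: lookup_update lookup_add lookup_single when_def in_keys_iff)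
    then show ?case using add[OF update(3) single, of k c] by (simp add: plus_tensor.abs_eq)
  qed
  then show ?thesis by (induct t rule: tensor.abs_induct)
qed

text \<open>The universal property, for an arbitrary complex vector space structure on the target, so
  that it also yields antilinear maps.\<close>

lemma tensor_universal:
  fixes \<beta> :: "'a::complex_vector \<Rightarrow> 'b::complex_vector \<Rightarrow> 'c::ab_group_add"
  assumes s: "vector_space s"
    and l: "\<And>b. Vector_Spaces.linear scaleC s (\<lambda>a. \<beta> a b)"
    and r: "\<And>a. Vector_Spaces.linear scaleC s (\<beta> a)"
  shows "\<exists>!L. Vector_Spaces.linear scaleC s L \<and> (\<forall>a b. L (a \<otimes> b) = \<beta> a b)"
proof (rule ex_ex1I)
  interpret s: vector_space s by fact
  define F where "F f = (\<Sum>k\<in>Poly_Mapping.keys f. s (Poly_Mapping.lookup f k) (case_prod \<beta> k))"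
    for f
  have F_sup: "F f = (\<Sum>k\<in>S. s (Poly_Mapping.lookup f k) (case_prod \<beta> k))"
    if "finite S" "Poly_Mapping.keys f \<subseteq> S" for f S
    unfolding F_def by (rule sum.mono_neutral_left) (use that in \<open>auto simp: in_keys_iff\<close>)
  have F_add: "F (f + g) = F f + F g" for f g
  proof -
    let ?S = "Poly_Mapping.keys f \<union> Poly_Mapping.keys g"
    have "Poly_Mapping.keys (f + g) \<subseteq> ?S" by (rule keys_add)
    then show ?thesis
      by (simp add: F_sup[of ?S] lookup_add s.scale_left_distrib sum.distrib)
  qed
  have F_scale: "F (free_scale c f) = s c (F f)" for c f
  proof -
    have "Poly_Mapping.keys (free_scale c f) \<subseteq> Poly_Mapping.keys f"
      by (auto simp: in_keys_iff)
    then show ?thesis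
      by (simp add: F_sup[of "Poly_Mapping.keys f"] s.scale_sum_right)
  qed
  have F_lin: "Vector_Spaces.linear free_scale s F"
    by unfold_locales (simp_all add: F_add F_scale s.scale_right_distrib s.scale_left_distrib)
  interpret F: Vector_Spaces.linear free_scale s F by fact
  have F_gen: "F (pair_generator a b) = \<beta> a b" for a b
    by (simp add: F_def)
  have "F f = 0" if "f \<in> bilinearity_relations" for f
    using that unfolding bilinearity_relations_def
    by (auto simp: F.diff F.scale F_gen
        module_hom.add[OF l[unfolded linear_iff_module_hom]]
        module_hom.add[OF r[unfolded linear_iff_module_hom]]
        module_hom.scale[OF l[unfolded linear_iff_module_hom]]
        module_hom.scale[OF r[unfolded linear_iff_module_hom]])
  then have F_span: "F f = 0" if "f \<in> free_vs.span bilinearity_relations" for f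
    using F.eq_0_on_span[OF _ that] by blast
  have F_rel: "F f = F g" if "tensor_rel f g" for f g
    using F_span[OF that[unfolded tensor_rel_def]] by (simp add: F.diff)
  define L where "L t = F (rep_tensor t)" for t
  have L_abs: "L (abs_tensor f) = F f" for f
    unfolding L_def
    by (rule F_rel, rule Quotient3_rep_abs[OF Quotient3_tensor])
      (simp add: tensor_rel_def free_vs.span_zero)
  have L_add: "L (x + y) = L x + L y" for x y
    by (induct x rule: tensor.abs_induct, induct y rule: tensor.abs_induct)
      (simp add: plus_tensor.abs_eq L_abs F_add)
  have L_scale: "L (c *\<^sub>C x) = s c (L x)" for c x
    by (induct x rule: tensor.abs_induct) (simp add: scaleC_tensor.abs_eq L_abs F_scale)
  have "Vector_Spaces.linear scaleC s L"
    by unfold_locales (simp_all add: L_add L_scale s.scale_right_distrib s.scale_left_distrib)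
  moreover have "L (a \<otimes> b) = \<beta> a b" for a b
    by (simp add: tensor_of.abs_eq L_abs F_gen)
  ultimately show "\<exists>L. Vector_Spaces.linear scaleC s L \<and> (\<forall>a b. L (a \<otimes> b) = \<beta> a b)" by blast
next
  fix L L' assume L: "Vector_Spaces.linear scaleC s L \<and> (\<forall>a b. L (a \<otimes> b) = \<beta> a b)"
    and L': "Vector_Spaces.linear scaleC s L' \<and> (\<forall>a b. L' (a \<otimes> b) = \<beta> a b)"
  interpret L: Vector_Spaces.linear scaleC s L using L by blast
  interpret L': Vector_Spaces.linear scaleC s L' using L' by blast
  show "L = L'"
  proof
    show "L t = L' t" for t
      by (induction t rule: tensor_induct) (use L L' in \<open>auto simp: L.add L'.add\<close>)
  qed
qed

definition tensor_map ::
    "('a::complex_vector \<Rightarrow> 'a) \<Rightarrow> ('b::complex_vector \<Rightarrow> 'b) \<Rightarrow> ('a, 'b) tensor \<Rightarrow> ('a, 'b) tensor"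
  where "tensor_map T1 T2 = (THE T. clinear T \<and> (\<forall>a b. T (a \<otimes> b) = T1 a \<otimes> T2 b))"

definition tensor_subspace ::
    "'a::complex_vector set \<Rightarrow> 'b::complex_vector set \<Rightarrow> ('a, 'b) tensor set"
  where "tensor_subspace U V = cvs.span {x \<otimes> y | x y. x \<in> U \<and> y \<in> V}"

lemma clinearI:
  assumes "\<And>x y. f (x + y) = f x + f y" "\<And>c x. f (c *\<^sub>C x) = c *\<^sub>C f x"
  shows "clinear f"
  by unfold_locales (auto simp: assms)

lemma clinear_add: "clinear f \<Longrightarrow> f (x + y) = f x + f y"
  and clinear_scale: "clinear f \<Longrightarrow> f (c *\<^sub>C x) = c *\<^sub>C f x"
  by (simp_all add: module_hom.add module_hom.scale linear_iff_module_hom)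

lemma tensor_map:
  assumes "clinear T1" "clinear T2"
  shows "clinear (tensor_map T1 T2)" and "tensor_map T1 T2 (a \<otimes> b) = T1 a \<otimes> T2 b"
proof -
  have "\<exists>!T. clinear T \<and> (\<forall>a b. T (a \<otimes> b) = T1 a \<otimes> T2 b)"
    by (rule tensor_universal)
      (auto intro!: clinearI cvs.vector_space_axioms simp: clinear_add[OF assms(1)] clinear_add[OF assms(2)]
        clinear_scale[OF assms(1)] clinear_scale[OF assms(2)]
        tensor_add_left tensor_add_right tensor_scale_left tensor_scale_right)
  from theI'[OF this] show "clinear (tensor_map T1 T2)" "tensor_map T1 T2 (a \<otimes> b) = T1 a \<otimes> T2 b"
    by (auto simp: tensor_map_def)
qed

section \<open>Quasi *-algebras\<close>

text \<open>The type is the vector space and \<open>core\<close> the *-algebra inside it. The product is a total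
  function, but it is meaningful, and constrained, only if one factor lies in the core.\<close>

record 'a quasi_star =
  core :: "'a set"
  qmult :: "'a \<Rightarrow> 'a \<Rightarrow> 'a" (infixl \<open>\<cdot>\<index>\<close> 70)
  qstar :: "'a \<Rightarrow> 'a" (\<open>_\<^sup>\<star>\<index>\<close> [1000] 999)

record 'a normed_quasi_star = "'a quasi_star" +
  qnorm :: "'a \<Rightarrow> real"

definition core_bilinear :: "'a::complex_vector set \<Rightarrow> ('a \<Rightarrow> 'a \<Rightarrow> 'a) \<Rightarrow> bool"
  where "core_bilinear X m \<longleftrightarrow>
    (\<forall>x\<in>X. clinear (\<lambda>a. m a x) \<and> clinear (\<lambda>a. m x a)) \<and>
    (\<forall>a. \<forall>x\<in>X. \<forall>y\<in>X. m a (x + y) = m a x + m a y \<and> m (x + y) a = m x a + m y a) \<and>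
    (\<forall>a c. \<forall>x\<in>X. m a (c *\<^sub>C x) = c *\<^sub>C m a x \<and> m (c *\<^sub>C x) a = c *\<^sub>C m x a)"

text \<open>Associativity and antimultiplicativity of the involution on the core are the instances of
  \<open>assoc_right\<close> and \<open>star_mult_right\<close> with all elements in the core.\<close>

locale quasi_star_algebra =
  fixes A :: "('a::complex_vector, 'm) quasi_star_scheme" (structure)
  assumes core_subspace: "cvs.subspace (core A)"
    and core_mult: "x \<in> core A \<Longrightarrow> y \<in> core A \<Longrightarrow> x \<cdot> y \<in> core A"
    and core_star: "x \<in> core A \<Longrightarrow> x\<^sup>\<star> \<in> core A"
    and mult_bilinear: "core_bilinear (core A) (qmult A)"
    and assoc_middle: "x \<in> core A \<Longrightarrow> y \<in> core A \<Longrightarrow> (x \<cdot> a) \<cdot> y = x \<cdot> (a \<cdot> y)"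
    and assoc_right: "x \<in> core A \<Longrightarrow> y \<in> core A \<Longrightarrow> a \<cdot> (x \<cdot> y) = (a \<cdot> x) \<cdot> y"
    and star_antilinear: "antilinear (qstar A)"
    and star_star: "(a\<^sup>\<star>)\<^sup>\<star> = a"
    and star_mult_right: "x \<in> core A \<Longrightarrow> (a \<cdot> x)\<^sup>\<star> = x\<^sup>\<star> \<cdot> a\<^sup>\<star>"
    and star_mult_left: "x \<in> core A \<Longrightarrow> (x \<cdot> a)\<^sup>\<star> = a\<^sup>\<star> \<cdot> x\<^sup>\<star>"

text \<open>That every normed quasi *-algebra has a unit of norm one is a standing convention.\<close>

locale normed_quasi_star_algebra = quasi_star_algebra A
  for A :: "('a::complex_vector, 'm) normed_quasi_star_scheme" (structure) +
  assumes norm: "is_norm (qnorm A)"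
    and norm_star: "qnorm A (a\<^sup>\<star>) = qnorm A a"
    and core_dense: "norm_topology (qnorm A) closure_of core A = UNIV"
    and mult_continuous: "x \<in> core A \<Longrightarrow>
      continuous_map (norm_topology (qnorm A)) (norm_topology (qnorm A)) (\<lambda>a. a \<cdot> x)"
    and unit: "\<exists>e\<in>core A. (\<forall>a. a \<cdot> e = a \<and> e \<cdot> a = a) \<and> qnorm A e = 1"

locale banach_quasi_star_algebra = normed_quasi_star_algebra +
  assumes complete: "norm_complete (qnorm A)"

section \<open>Full representability\<close>

definition representable :: "('a::complex_vector, 'm) quasi_star_scheme \<Rightarrow> ('a \<Rightarrow> complex) \<Rightarrow> bool"
  where "representable A \<omega> \<longleftrightarrow>
    linear_functional \<omega> \<and>
    (\<forall>x\<in>core A. \<omega> (x\<^sup>\<star>\<^bsub>A\<^esub> \<cdot>\<^bsub>A\<^esub> x) \<ge> 0) \<and>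
    (\<forall>x\<in>core A. \<forall>y\<in>core A. \<forall>a.
      \<omega> (y\<^sup>\<star>\<^bsub>A\<^esub> \<cdot>\<^bsub>A\<^esub> a\<^sup>\<star>\<^bsub>A\<^esub> \<cdot>\<^bsub>A\<^esub> x) = cnj (\<omega> (x\<^sup>\<star>\<^bsub>A\<^esub> \<cdot>\<^bsub>A\<^esub> a \<cdot>\<^bsub>A\<^esub> y))) \<and>
    (\<forall>a. \<exists>\<gamma>>0. \<forall>x\<in>core A.
      cmod (\<omega> (a\<^sup>\<star>\<^bsub>A\<^esub> \<cdot>\<^bsub>A\<^esub> x)) \<le> \<gamma> * sqrt (Re (\<omega> (x\<^sup>\<star>\<^bsub>A\<^esub> \<cdot>\<^bsub>A\<^esub> x))))"

definition continuous_representables ::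
    "('a::complex_vector, 'm) normed_quasi_star_scheme \<Rightarrow> ('a \<Rightarrow> complex) set"
  where "continuous_representables A =
    {\<omega>. representable A \<omega> \<and> continuous_map (norm_topology (qnorm A)) euclidean \<omega>}"

definition induced_form ::
    "('a::complex_vector, 'm) quasi_star_scheme \<Rightarrow> ('a \<Rightarrow> complex) \<Rightarrow> 'a \<Rightarrow> 'a \<Rightarrow> complex"
  where "induced_form A \<omega> x y = \<omega> (y\<^sup>\<star>\<^bsub>A\<^esub> \<cdot>\<^bsub>A\<^esub> x)"

definition closure_domain ::
    "('a::complex_vector, 'm) normed_quasi_star_scheme \<Rightarrow> ('a \<Rightarrow> complex) \<Rightarrow> 'a set"
  where "closure_domain A \<omega> =
    {a. \<exists>x :: nat \<Rightarrow> 'a. (\<forall>k. x k \<in> core A) \<and>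
      (\<lambda>k. qnorm A (x k - a)) \<longlonglongrightarrow> 0 \<and>
      ((\<lambda>(k, l). induced_form A \<omega> (x k - x l) (x k - x l)) \<longlongrightarrow> 0) (sequentially \<times>\<^sub>F sequentially)}"

definition representable_part :: "('a::complex_vector, 'm) normed_quasi_star_scheme \<Rightarrow> 'a set"
  where "representable_part A =
    (if continuous_representables A = {\<lambda>_. 0} then UNIV
     else (\<Inter>\<omega>\<in>continuous_representables A. closure_domain A \<omega>))"

definition positive_cone :: "('a::complex_vector, 'm) normed_quasi_star_scheme \<Rightarrow> 'a set"
  where "positive_cone A = norm_topology (qnorm A) closure_of
    {(\<Sum>k=1..n. (x k)\<^sup>\<star>\<^bsub>A\<^esub> \<cdot>\<^bsub>A\<^esub> x k) | (n::nat) x. \<forall>k\<in>{1..n}. x k \<in> core A}"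

definition sufficient_representables :: "('a::complex_vector, 'm) normed_quasi_star_scheme \<Rightarrow> bool"
  where "sufficient_representables A \<longleftrightarrow>
    (\<forall>a\<in>positive_cone A. a \<noteq> 0 \<longrightarrow> (\<exists>\<omega>\<in>continuous_representables A. \<omega> a > 0))"

definition fully_representable :: "('a::complex_vector, 'm) normed_quasi_star_scheme \<Rightarrow> bool"
  where "fully_representable A \<longleftrightarrow> sufficient_representables A \<and> representable_part A = UNIV"

section \<open>Tensor products of quasi *-algebras\<close>

text \<open>On the pairs with a factor in the core the product is determined by bilinearity and the
  values on elementary tensors; the last conjunct only fixes the irrelevant values.\<close>

definition is_tensor_mult ::
    "('a::complex_vector, 'm) quasi_star_scheme \<Rightarrow> ('b::complex_vector, 'l) quasi_star_scheme \<Rightarrow>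
      (('a, 'b) tensor \<Rightarrow> ('a, 'b) tensor \<Rightarrow> ('a, 'b) tensor) \<Rightarrow> bool"
  where "is_tensor_mult A B m \<longleftrightarrow>
    core_bilinear (tensor_subspace (core A) (core B)) m \<and>
    (\<forall>a b. \<forall>x\<in>core A. \<forall>y\<in>core B.
      m (a \<otimes> b) (x \<otimes> y) = (a \<cdot>\<^bsub>A\<^esub> x) \<otimes> (b \<cdot>\<^bsub>B\<^esub> y) \<and>
      m (x \<otimes> y) (a \<otimes> b) = (x \<cdot>\<^bsub>A\<^esub> a) \<otimes> (y \<cdot>\<^bsub>B\<^esub> b)) \<and>
    (\<forall>s t. s \<notin> tensor_subspace (core A) (core B) \<longrightarrow> t \<notin> tensor_subspace (core A) (core B) \<longrightarrow>
      m s t = 0)"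

definition is_tensor_star ::
    "('a::complex_vector, 'm) quasi_star_scheme \<Rightarrow> ('b::complex_vector, 'l) quasi_star_scheme \<Rightarrow>
      (('a, 'b) tensor \<Rightarrow> ('a, 'b) tensor) \<Rightarrow> bool"
  where "is_tensor_star A B S \<longleftrightarrow>
    antilinear S \<and> (\<forall>a b. S (a \<otimes> b) = a\<^sup>\<star>\<^bsub>A\<^esub> \<otimes> b\<^sup>\<star>\<^bsub>B\<^esub>)"

definition tensor_quasi_star ::
    "('a::complex_vector, 'm) quasi_star_scheme \<Rightarrow> ('b::complex_vector, 'l) quasi_star_scheme \<Rightarrow>
      (('a, 'b) tensor \<Rightarrow> real) \<Rightarrow> ('a, 'b) tensor normed_quasi_star"
  where "tensor_quasi_star A B n =
    \<lparr>core = tensor_subspace (core A) (core B),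
     qmult = (THE m. is_tensor_mult A B m),
     qstar = (THE S. is_tensor_star A B S),
     qnorm = n\<rparr>"

definition cross_norm ::
    "('a::complex_vector \<Rightarrow> real) \<Rightarrow> ('b::complex_vector \<Rightarrow> real) \<Rightarrow> (('a, 'b) tensor \<Rightarrow> real) \<Rightarrow> bool"
  where "cross_norm nA nB n \<longleftrightarrow> is_norm n \<and> (\<forall>a b. n (a \<otimes> b) = nA a * nB b)"

text \<open>The extension of a bounded operator to the completion has the same operator norm as the
  operator itself, so the completion is not needed to state the bound.\<close>

definition uniform_cross_norm ::
    "('a::complex_vector \<Rightarrow> real) \<Rightarrow> ('b::complex_vector \<Rightarrow> real) \<Rightarrow> (('a, 'b) tensor \<Rightarrow> real) \<Rightarrow> bool"
  where "uniform_cross_norm nA nB n \<longleftrightarrow>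
    cross_norm nA nB n \<and>
    (\<forall>T1 T2. bounded_operator nA T1 \<longrightarrow> bounded_operator nB T2 \<longrightarrow>
      bounded_operator n (tensor_map T1 T2) \<and>
      operator_norm n (tensor_map T1 T2) \<le> operator_norm nA T1 * operator_norm nB T2)"

text \<open>The descriptions in \<open>tensor_quasi_star\<close> denote.\<close>

lemma tensor_star_unique:
  fixes A :: "('a::complex_vector, 'm) quasi_star_scheme"
    and B :: "('b::complex_vector, 'l) quasi_star_scheme"
  assumes "quasi_star_algebra A" "quasi_star_algebra B"
  shows "\<exists>!S. is_tensor_star A B S"
proof -
  interpret A: quasi_star_algebra A by fact
  interpret B: quasi_star_algebra B by fact
  let ?s = "\<lambda>c. (*\<^sub>C) (cnj c) :: ('a, 'b) tensor \<Rightarrow> ('a, 'b) tensor"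
  have s: "vector_space ?s"
    by unfold_locales (auto simp: cvs.scale_right_distrib cvs.scale_left_distrib)
  have lin: "Vector_Spaces.linear scaleC ?s f \<longleftrightarrow> antilinear f" for f :: "'c::complex_vector \<Rightarrow> _"
  proof
    assume "Vector_Spaces.linear scaleC ?s f"
    then interpret Vector_Spaces.linear scaleC ?s f .
    show "antilinear f" by (auto simp: antilinear_def add scale)
  next
    assume f: "antilinear f"
    interpret s: vector_space ?s by fact
    show "Vector_Spaces.linear scaleC ?s f"
      by unfold_locales (use f in \<open>auto simp: antilinear_def s.scale_right_distrib s.scale_left_distrib\<close>)
  qed
  have "\<exists>!S. Vector_Spaces.linear scaleC ?s S \<and> (\<forall>a b. S (a \<otimes> b) = a\<^sup>\<star>\<^bsub>A\<^esub> \<otimes> b\<^sup>\<star>\<^bsub>B\<^esub>)"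
    by (rule tensor_universal[OF s], unfold lin)
      (use A.star_antilinear B.star_antilinear in
        \<open>auto simp: antilinear_def tensor_add_left tensor_add_right tensor_scale_left tensor_scale_right\<close>)
  then show ?thesis by (simp add: lin is_tensor_star_def)
qed

lemma exists_projection:
  fixes U :: "'a::complex_vector set"
  assumes "cvs.subspace U"
  obtains P where "clinear P" "\<And>x. P x \<in> U" "\<And>x. x \<in> U \<Longrightarrow> P x = x"
proof -
  interpret vector_space_pair "scaleC :: complex \<Rightarrow> 'a \<Rightarrow> 'a" "scaleC :: complex \<Rightarrow> 'a \<Rightarrow> 'a" ..
  have "\<exists>g. g \<in> UNIV \<rightarrow> U \<and> clinear g \<and> (\<forall>v\<in>U. g (id v) = v)"
    using linear_exists_left_inverse_on[OF cvs.linear_id assms] by (auto simp: inj_on_def)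
  then show ?thesis using that by auto
qed

lemma core_bilinearD:
  assumes "core_bilinear X m" "x \<in> X"
  shows "m (a + b) x = m a x + m b x" "m (c *\<^sub>C a) x = c *\<^sub>C m a x"
    "m x (a + b) = m x a + m x b" "m x (c *\<^sub>C a) = c *\<^sub>C m x a"
    "m a (c *\<^sub>C x) = c *\<^sub>C m a x" "m (c *\<^sub>C x) a = c *\<^sub>C m x a"
    "y \<in> X \<Longrightarrow> m a (x + y) = m a x + m a y" "y \<in> X \<Longrightarrow> m (x + y) a = m x a + m y a"
  using assms clinear_add[of "\<lambda>a. m a x"] clinear_scale[of "\<lambda>a. m a x"]
  by (auto simp: core_bilinear_def clinear_add clinear_scale)

lemma tensor_subspace_induct [consumes 2, case_names zero add generator]:
  assumes t: "t \<in> tensor_subspace U V" and U: "cvs.subspace U"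
    and zero: "P 0"
    and add: "\<And>s t. s \<in> tensor_subspace U V \<Longrightarrow> t \<in> tensor_subspace U V \<Longrightarrow> P s \<Longrightarrow> P t \<Longrightarrow> P (s + t)"
    and gen: "\<And>x y. x \<in> U \<Longrightarrow> y \<in> V \<Longrightarrow> P (x \<otimes> y)"
  shows "P t"
proof -
  have "t \<in> tensor_subspace U V \<and> P t"
    using t unfolding tensor_subspace_def
  proof (induction rule: cvs.span_induct_alt)
    case base
    show ?case by (simp add: zero cvs.span_zero)
  next
    case (step c g t)
    then obtain x y where g: "g = x \<otimes> y" and xy: "x \<in> U" "y \<in> V" by blast
    have cx: "c *\<^sub>C x \<in> U" by (rule cvs.subspace_scale[OF U xy(1)])
    have mem: "(c *\<^sub>C x) \<otimes> y \<in> tensor_subspace U V"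
      unfolding tensor_subspace_def by (rule cvs.span_base) (use cx xy in blast)
    have eq: "c *\<^sub>C g + t = (c *\<^sub>C x) \<otimes> y + t" by (simp add: g tensor_scale_left)
    have "t \<in> tensor_subspace U V" "P t" using step by (auto simp: tensor_subspace_def)
    with add[OF mem _ gen[OF cx xy(2)]] mem show ?case
      unfolding eq by (auto simp: tensor_subspace_def intro: cvs.span_add)
  qed
  then show ?thesis ..
qed

lemma tensor_bilinear_lift:
  fixes f :: "'a::complex_vector \<Rightarrow> 'a \<Rightarrow> 'a" and g :: "'b::complex_vector \<Rightarrow> 'b \<Rightarrow> 'b"
  assumes f: "\<And>x. clinear (\<lambda>a. f a x)" "\<And>a. clinear (f a)"
    and g: "\<And>x. clinear (\<lambda>a. g a x)" "\<And>a. clinear (g a)"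
  obtains M where "\<And>t. clinear (\<lambda>s. M s t)" "\<And>s. clinear (M s)"
    "\<And>a b x y. M (a \<otimes> b) (x \<otimes> y) = f a x \<otimes> g b y"
proof -
  note lin = clinear_add[OF f(1)] clinear_add[OF f(2)] clinear_add[OF g(1)] clinear_add[OF g(2)]
    clinear_scale[OF f(1)] clinear_scale[OF f(2)] clinear_scale[OF g(1)] clinear_scale[OF g(2)]
    tensor_add_left tensor_add_right tensor_scale_left tensor_scale_right
  define R where "R x y = tensor_map (\<lambda>a. f a x) (\<lambda>b. g b y)" for x y
  have R_lin: "clinear (R x y)" and R: "R x y (a \<otimes> b) = f a x \<otimes> g b y" for x y a b
    using tensor_map[OF f(1) g(1)] by (auto simp: R_def)
  note R_add = clinear_add[OF R_lin] and R_scale = clinear_scale[OF R_lin]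
  have R1: "R (x + x') y s = R x y s + R x' y s" for x x' y s
    by (induction s rule: tensor_induct) (simp_all add: R R_add lin algebra_simps)
  have R2: "R x (y + y') s = R x y s + R x y' s" for x y y' s
    by (induction s rule: tensor_induct) (simp_all add: R R_add lin algebra_simps)
  have R3: "R (c *\<^sub>C x) y s = c *\<^sub>C R x y s" for c x y s
    by (induction s rule: tensor_induct) (simp_all add: R R_add lin cvs.scale_right_distrib)
  have R4: "R x (c *\<^sub>C y) s = c *\<^sub>C R x y s" for c x y s
    by (induction s rule: tensor_induct) (simp_all add: R R_add lin cvs.scale_right_distrib)
  have "\<exists>L. clinear L \<and> (\<forall>x y. L (x \<otimes> y) = R x y s)" for s
    using tensor_universal[OF cvs.vector_space_axioms, of "\<lambda>x y. R x y s"]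
    by (blast intro: clinearI R1 R2 R3 R4)
  then obtain M where M_lin: "clinear (M s)" and M: "M s (x \<otimes> y) = R x y s" for s x y
    by metis
  note M_add = clinear_add[OF M_lin]
  have "clinear (\<lambda>s. M s t)" for t
  proof (rule clinearI)
    show "M (s + s') t = M s t + M s' t" for s s'
      by (induction t rule: tensor_induct) (simp_all add: M M_add R_add algebra_simps)
    show "M (c *\<^sub>C s) t = c *\<^sub>C M s t" for c s
      by (induction t rule: tensor_induct) (simp_all add: M M_add R_scale cvs.scale_right_distrib)
  qed
  then show ?thesis using M_lin by (rule that[of M]) (simp add: M R)
qed

lemma tensor_mult_unique:
  fixes A :: "('a::complex_vector, 'm) quasi_star_scheme"
    and B :: "('b::complex_vector, 'l) quasi_star_scheme"
  assumes "quasi_star_algebra A" "quasi_star_algebra B"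
  shows "\<exists>!m. is_tensor_mult A B m"
proof (rule ex_ex1I)
  interpret A: quasi_star_algebra A by fact
  interpret B: quasi_star_algebra B by fact
  let ?T = "tensor_subspace (core A) (core B)"
  have sub: "cvs.subspace ?T" by (simp add: tensor_subspace_def)
  obtain P where P: "clinear P" "\<And>x. P x \<in> core A" "\<And>x. x \<in> core A \<Longrightarrow> P x = x"
    using exists_projection[OF A.core_subspace] by blast
  obtain Q where Q: "clinear Q" "\<And>x. Q x \<in> core B" "\<And>x. x \<in> core B \<Longrightarrow> Q x = x"
    using exists_projection[OF B.core_subspace] by blast
  note lin = clinear_add[OF P(1)] clinear_add[OF Q(1)] clinear_scale[OF P(1)] clinear_scale[OF Q(1)]
    core_bilinearD[OF A.mult_bilinear] core_bilinearD[OF B.mult_bilinear] P(2) Q(2)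
  obtain R where R: "\<And>t. clinear (\<lambda>s. R s t)" "\<And>s. clinear (R s)"
    "\<And>a b x y. R (a \<otimes> b) (x \<otimes> y) = (a \<cdot>\<^bsub>A\<^esub> P x) \<otimes> (b \<cdot>\<^bsub>B\<^esub> Q y)"
    by (rule tensor_bilinear_lift[of "\<lambda>a x. a \<cdot>\<^bsub>A\<^esub> P x" "\<lambda>b y. b \<cdot>\<^bsub>B\<^esub> Q y"])
      (auto simp: lin intro!: clinearI)
  obtain L where L: "\<And>t. clinear (\<lambda>s. L s t)" "\<And>s. clinear (L s)"
    "\<And>x y a b. L (x \<otimes> y) (a \<otimes> b) = (P x \<cdot>\<^bsub>A\<^esub> a) \<otimes> (Q y \<cdot>\<^bsub>B\<^esub> b)"
    by (rule tensor_bilinear_lift[of "\<lambda>x a. P x \<cdot>\<^bsub>A\<^esub> a" "\<lambda>y b. Q y \<cdot>\<^bsub>B\<^esub> b"])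
      (auto simp: lin intro!: clinearI)
  note RL = clinear_add[OF R(1)] clinear_add[OF R(2)] clinear_add[OF L(1)] clinear_add[OF L(2)]
    clinear_scale[OF R(1)] clinear_scale[OF R(2)] clinear_scale[OF L(1)] clinear_scale[OF L(2)]
  have zero: "R 0 t = 0" "R s 0 = 0" "L 0 t = 0" "L s 0 = 0" for s t
    using RL(5)[of 0 0 t] RL(6)[of s 0 0] RL(7)[of 0 0 t] RL(8)[of s 0 0] by simp_all
  have eq: "R s t = L s t" if "s \<in> ?T" "t \<in> ?T" for s t
    using that(1) A.core_subspace
  proof (induction rule: tensor_subspace_induct)
    case (generator x y)
    note xy = generator
    show ?case
      using that(2) A.core_subspace
      by (induction rule: tensor_subspace_induct) (use xy in \<open>auto simp: zero RL R(3) L(3) P(3) Q(3)\<close>)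
  qed (auto simp: zero RL)
  define m where "m s t = (if t \<in> ?T then R s t else if s \<in> ?T then L s t else 0)" for s t
  have mR: "t \<in> ?T \<Longrightarrow> m s t = R s t" and mL: "s \<in> ?T \<Longrightarrow> m s t = L s t" for s t
    by (auto simp: m_def eq)
  have base: "x \<otimes> y \<in> ?T" if "x \<in> core A" "y \<in> core B" for x y
    unfolding tensor_subspace_def by (rule cvs.span_base) (use that in blast)
  have "core_bilinear ?T m"
    using cvs.subspace_add[OF sub] cvs.subspace_scale[OF sub]
    by (auto simp: core_bilinear_def mR mL RL intro!: clinearI)
  then have "is_tensor_mult A B m"
    by (auto simp: is_tensor_mult_def mR mL base R(3) L(3) P(3) Q(3)) (simp add: m_def)
  then show "\<exists>m. is_tensor_mult A B m" by blast
next
  interpret A: quasi_star_algebra A by fact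
  let ?T = "tensor_subspace (core A) (core B)"
  fix m m' assume m: "is_tensor_mult A B m" and m': "is_tensor_mult A B m'"
  have bil: "core_bilinear ?T m" "core_bilinear ?T m'"
    using m m' by (auto simp: is_tensor_mult_def)
  note lin = core_bilinearD[OF bil(1)] core_bilinearD[OF bil(2)]
  have base: "x \<otimes> y \<in> ?T" if "x \<in> core A" "y \<in> core B" for x y
    unfolding tensor_subspace_def by (rule cvs.span_base) (use that in blast)
  have zT: "0 \<in> ?T" by (simp add: tensor_subspace_def cvs.span_zero)
  have zero: "m s 0 = 0" "m 0 s = 0" "m' s 0 = 0" "m' 0 s = 0" for s
    using lin(5)[OF zT, of s 0] lin(6)[OF zT, of 0 s] lin(13)[OF zT, of s 0] lin(14)[OF zT, of 0 s]
    by simp_all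
  have gen: "m s (x \<otimes> y) = m' s (x \<otimes> y)" "m (x \<otimes> y) s = m' (x \<otimes> y) s"
    if "x \<in> core A" "y \<in> core B" for s x y
  proof -
    show "m s (x \<otimes> y) = m' s (x \<otimes> y)"
      by (induction s rule: tensor_induct)
        (use m m' that base[OF that] in \<open>auto simp: lin is_tensor_mult_def\<close>)
    show "m (x \<otimes> y) s = m' (x \<otimes> y) s"
      by (induction s rule: tensor_induct)
        (use m m' that base[OF that] in \<open>auto simp: lin is_tensor_mult_def\<close>)
  qed
  have "m s t = m' s t" if "t \<in> ?T" for s t
    using that A.core_subspace
    by (induction rule: tensor_subspace_induct) (auto simp: zero gen lin)
  moreover have "m t s = m' t s" if "t \<in> ?T" for s t
    using that A.core_subspace
    by (induction rule: tensor_subspace_induct) (auto simp: zero gen lin)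
  ultimately show "m = m'"
    using m m' by (intro ext) (metis is_tensor_mult_def)
qed

end

theory Submission
  imports Defs
begin

text \<open>Restricting a representable functional \<open>\<Omega>\<close> of the tensor product to \<open>a \<mapsto> \<Omega> (a \<otimes> e)\<close>
  gives sufficiency for each factor. For the domains, let \<open>\<omega>\<close> be representable on \<open>A\<close> and use
  sufficiency of \<open>B\<close> to choose \<open>\<rho>\<close> representable on \<open>B\<close> with \<open>\<rho> e > 0\<close>. Uniformity of the
  cross-norm makes the slice map \<open>S (a \<otimes> b) = \<rho> b *\<^sub>C a\<close> bounded, and the Schur product theorem
  shows that \<open>\<Omega> = \<omega> \<circ> S\<close> is representable and that
  \<open>\<omega> ((S z)* (S z)) \<le> \<gamma>\<^sup>2 \<Omega> (z* z)\<close>. Hence \<open>S\<close> maps a sequence witnessing that \<open>a \<otimes> e\<close> lies in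
  the domain for \<open>\<Omega>\<close> to one witnessing that \<open>\<rho> e *\<^sub>C a\<close> lies in the domain for \<open>\<omega>\<close>.\<close>

section \<open>Positive kernels\<close>

text \<open>On finite index sets these are the positive semidefinite Hermitian matrices. The order
  is that of the complex numbers, so the inequality also says that the sum is real. The conjugate
  sits on the second index because the Gram kernels below are
  \<open>\<omega> ((x j)\<^sup>\<star> \<cdot> x i)\<close>, linear in the vector with index
  \<open>i\<close>.\<close>

definition positive_kernel :: "'i set \<Rightarrow> ('i \<Rightarrow> 'i \<Rightarrow> complex) \<Rightarrow> bool"
  where "positive_kernel S M \<longleftrightarrow>
    (\<forall>i\<in>S. \<forall>j\<in>S. M j i = cnj (M i j)) \<and>
    (\<forall>c. 0 \<le> (\<Sum>i\<in>S. \<Sum>j\<in>S. c i * cnj (c j) * M i j))"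

lemma positive_kernelI:
  assumes "\<And>i j. i \<in> S \<Longrightarrow> j \<in> S \<Longrightarrow> M j i = cnj (M i j)"
    and "\<And>c. 0 \<le> (\<Sum>i\<in>S. \<Sum>j\<in>S. c i * cnj (c j) * M i j)"
  shows "positive_kernel S M"
  using assms unfolding positive_kernel_def by blast

lemma positive_kernel_hermitian:
  assumes "positive_kernel S M" "i \<in> S" "j \<in> S"
  shows "M j i = cnj (M i j)"
  using assms unfolding positive_kernel_def by blast

lemma positive_kernel_sum:
  assumes "positive_kernel S M"
  shows "0 \<le> (\<Sum>i\<in>S. \<Sum>j\<in>S. c i * cnj (c j) * M i j)"
  using assms unfolding positive_kernel_def by blast

text \<open>Isolates the dependence on the single coefficient \<open>c p\<close>, so that the square
  in it can be completed.\<close>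

lemma quadratic_sum_insert:
  fixes M :: "'i \<Rightarrow> 'i \<Rightarrow> complex"
  assumes "finite S" "p \<notin> S" and h: "\<And>i. i \<in> S \<Longrightarrow> M p i = cnj (M i p)"
  shows "(\<Sum>i\<in>insert p S. \<Sum>j\<in>insert p S. c i * cnj (c j) * M i j) =
    c p * cnj (c p) * M p p + c p * cnj (\<Sum>i\<in>S. c i * M i p) + cnj (c p) * (\<Sum>i\<in>S. c i * M i p) +
    (\<Sum>i\<in>S. \<Sum>j\<in>S. c i * cnj (c j) * M i j)"
  using assms by (simp add: sum.distrib sum_distrib_left mult_ac)

text \<open>Coefficients on \<open>R\<close> are extended by zero to \<open>S\<close>.\<close>

lemma positive_kernel_subset:
  assumes "positive_kernel S M" "R \<subseteq> S" "finite S"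
  shows "positive_kernel R M"
proof (rule positive_kernelI)
  show "M j i = cnj (M i j)" if "i \<in> R" "j \<in> R" for i j
    using positive_kernel_hermitian[OF assms(1)] that assms(2) by blast
  fix c :: "'a \<Rightarrow> complex"
  let ?c = "\<lambda>i. if i \<in> R then c i else 0"
  have "(\<Sum>i\<in>S. \<Sum>j\<in>S. ?c i * cnj (?c j) * M i j) = (\<Sum>i\<in>R. \<Sum>j\<in>S. ?c i * cnj (?c j) * M i j)"
    using assms by (intro sum.mono_neutral_right) auto
  also have "\<dots> = (\<Sum>i\<in>R. \<Sum>j\<in>R. ?c i * cnj (?c j) * M i j)"
    using assms by (intro sum.cong refl sum.mono_neutral_right) auto
  finally show "0 \<le> (\<Sum>i\<in>R. \<Sum>j\<in>R. c i * cnj (c j) * M i j)"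
    using positive_kernel_sum[OF assms(1), of ?c] by simp
qed

lemma positive_kernel_diagonal:
  assumes "positive_kernel S M" "finite S" "p \<in> S"
  shows "0 \<le> M p p"
proof -
  have "positive_kernel {p} M"
    using assms by (intro positive_kernel_subset[OF assms(1)]) auto
  from positive_kernel_sum[OF this, of "\<lambda>_. 1"] show ?thesis by simp
qed

text \<open>With coefficient 1 at \<open>i\<close> and \<open>- r * M i p\<close> at
  \<open>p\<close>, the form is affine in \<open>r\<close> because \<open>M p p = 0\<close>. It
  stays nonnegative for every real \<open>r\<close> only if its slope, a multiple of the squared
  modulus of \<open>M i p\<close>, vanishes.\<close>

lemma positive_kernel_null:
  assumes M: "positive_kernel S M" and S: "finite S" "p \<in> S" "i \<in> S" and null: "M p p = 0"
  shows "M i p = 0"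
proof (cases "i = p")
  case False
  have h: "M p i = cnj (M i p)"
    using positive_kernel_hermitian[OF M] S by blast
  have "positive_kernel {i, p} M"
    using S by (intro positive_kernel_subset[OF M]) auto
  note q = positive_kernel_sum[OF this]
  have "0 \<le> Re (M i i) - 2 * r * (cmod (M i p))\<^sup>2" for r :: real
  proof -
    let ?c = "\<lambda>k. if k = p then - of_real r * M i p else 1"
    have "(\<Sum>k\<in>{i, p}. \<Sum>l\<in>{i, p}. ?c k * cnj (?c l) * M k l) =
        M i i - 2 * of_real r * (M i p * cnj (M i p))"
      using False by (simp add: h null algebra_simps)
    also have "\<dots> = M i i - of_real (2 * r * (cmod (M i p))\<^sup>2)"
      unfolding complex_norm_square[symmetric] by simp
    finally show ?thesis
      using q[of ?c] by (simp add: less_eq_complex_def)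
  qed
  \<comment> \<open>This \<open>r\<close> makes the subtracted term equal to
    \<open>Re (M i i) + 1\<close>, one more than nonnegativity permits.\<close>
  note bound = this[of "(Re (M i i) + 1) / (2 * (cmod (M i p))\<^sup>2)"]
  show ?thesis
  proof (rule ccontr)
    assume "M i p \<noteq> 0"
    then have "2 * ((Re (M i i) + 1) / (2 * (cmod (M i p))\<^sup>2)) * (cmod (M i p))\<^sup>2 = Re (M i i) + 1"
      by simp
    with bound show False by linarith
  qed
qed (use null in simp)

text \<open>If \<open>M p p = 0\<close>, the fraction is \<open>0\<close> and the kernel is unchanged.\<close>

lemma positive_kernel_schur_complement:
  assumes M: "positive_kernel (insert p S) M" and S: "finite S" "p \<notin> S"
  shows "positive_kernel S (\<lambda>i j. M i j - M i p * M p j / M p p)"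
proof (rule positive_kernelI)
  note h = positive_kernel_hermitian[OF M]
  have real: "cnj (M p p) = M p p" by (rule h[symmetric]) simp_all
  have hp: "M p i = cnj (M i p)" if "i \<in> S" for i
    using that by (intro h) simp_all
  show "M j i - M j p * M p i / M p p = cnj (M i j - M i p * M p j / M p p)"
    if "i \<in> S" "j \<in> S" for i j
    using that h[of i j] h[of j p] h[of p i] by (simp add: real)
  fix c :: "'a \<Rightarrow> complex"
  define C where "C = (\<Sum>i\<in>S. c i * M i p)"
  have cC: "cnj C = (\<Sum>j\<in>S. cnj (c j) * M p j)"
    by (simp add: C_def hp)
  \<comment> \<open>Completing the square: for \<open>M p p \<noteq> 0\<close> this coefficient at
    \<open>p\<close> minimises the form, and the terms involving \<open>p\<close> collapse to
    \<open>- C * cnj C / M p p\<close>.\<close>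
  let ?c = "\<lambda>k. if k = p then - C / M p p else c k"
  have restr: "(\<Sum>i\<in>S. ?c i * M i p) = C"
    "(\<Sum>i\<in>S. \<Sum>j\<in>S. ?c i * cnj (?c j) * M i j) = (\<Sum>i\<in>S. \<Sum>j\<in>S. c i * cnj (c j) * M i j)"
    using S by (auto simp: C_def intro!: sum.cong)
  have "0 \<le> (\<Sum>i\<in>insert p S. \<Sum>j\<in>insert p S. ?c i * cnj (?c j) * M i j)"
    by (rule positive_kernel_sum[OF M])
  also have "\<dots> = (\<Sum>i\<in>S. \<Sum>j\<in>S. c i * cnj (c j) * M i j) - C * cnj C / M p p"
    using S by (subst quadratic_sum_insert) (auto simp: restr real hp)
  also have "\<dots> = (\<Sum>i\<in>S. \<Sum>j\<in>S. c i * cnj (c j) * (M i j - M i p * M p j / M p p))"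
    unfolding cC unfolding C_def sum_product
    by (simp add: sum_subtractf sum_divide_distrib right_diff_distrib mult_ac)
  finally show "0 \<le> \<dots>" .
qed

text \<open>Splitting off the rank one kernel \<open>M i p * M p j / M p p\<close> leaves a kernel that lives on
  one point less.\<close>

theorem schur_product_sum_nonneg:
  assumes "finite S" "positive_kernel S M" "positive_kernel S N"
  shows "0 \<le> (\<Sum>i\<in>S. \<Sum>j\<in>S. M i j * N i j)"
  using assms
proof (induction S arbitrary: M rule: finite_induct)
  case (insert p S)
  note M = insert.prems(1) and N = insert.prems(2)
  note h = positive_kernel_hermitian[OF M]
  let ?S = "insert p S"
  define M' where "M' i j = M i j - M i p * M p j / M p p" for i j
  \<comment> \<open>For \<open>M p p \<noteq> 0\<close> this is cancellation. For
    \<open>M p p = 0\<close> the fraction is 0, so \<open>M'\<close> agrees with \<open>M\<close>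
    and \<open>positive_kernel_null\<close> supplies the zeros.\<close>
  have edge: "M' i p = 0" "M' p i = 0" if "i \<in> ?S" for i
    using positive_kernel_null[OF M _ _ that] insert.hyps that h[of i p] by (auto simp: M'_def)
  have "0 \<le> (\<Sum>i\<in>S. \<Sum>j\<in>S. M' i j * N i j)"
    unfolding M'_def
    by (rule insert.IH[OF positive_kernel_schur_complement[OF M insert.hyps]])
      (rule positive_kernel_subset[OF N], use insert.hyps in auto)
  also have "\<dots> = (\<Sum>i\<in>?S. \<Sum>j\<in>?S. M' i j * N i j)"
    using insert.hyps edge by simp
  finally have 1: "0 \<le> (\<Sum>i\<in>?S. \<Sum>j\<in>?S. M' i j * N i j)" .
  have "0 \<le> M p p"
    using positive_kernel_diagonal[OF M] insert.hyps by simp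
  then have pos: "0 \<le> 1 / M p p"
    by (simp add: less_eq_complex_def complex_is_Real_iff Re_divide Im_divide)
  \<comment> \<open>The contribution of the rank one part is the quadratic form of \<open>N\<close>
    with the column entries \<open>M i p\<close> as coefficients.\<close>
  have "0 \<le> (1 / M p p) * (\<Sum>i\<in>?S. \<Sum>j\<in>?S. M i p * cnj (M j p) * N i j)"
    by (rule mult_nonneg_nonneg[OF pos positive_kernel_sum[OF N]])
  also have "\<dots> = (\<Sum>i\<in>?S. \<Sum>j\<in>?S. M i p * M p j / M p p * N i j)"
    unfolding sum_distrib_left by (intro sum.cong refl) (simp add: h[of _ p, symmetric])
  finally have "0 \<le> \<dots>" .
  with 1 have "0 \<le> (\<Sum>i\<in>?S. \<Sum>j\<in>?S. M' i j * N i j) +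
      (\<Sum>i\<in>?S. \<Sum>j\<in>?S. M i p * M p j / M p p * N i j)"
    by (rule add_nonneg_nonneg)
  also have "\<dots> = (\<Sum>i\<in>?S. \<Sum>j\<in>?S. M i j * N i j)"
    unfolding sum.distrib[symmetric] by (intro sum.cong refl) (simp add: M'_def algebra_simps)
  finally show ?case .
qed simp

section \<open>Norms and continuity\<close>

lemma
  assumes "is_norm n"
  shows is_norm_zero: "n x = 0 \<longleftrightarrow> x = 0"
    and is_norm_scale: "n (c *\<^sub>C x) = cmod c * n x"
    and is_norm_nonneg: "0 \<le> n x"
  using assms Metric_space.nonneg[OF is_norm_Metric_space[OF assms], of x 0]
  by (auto simp: is_norm_def)

lemma in_closure_norm_topology:
  assumes "is_norm n"
  shows "a \<in> norm_topology n closure_of S \<longleftrightarrow> (\<forall>r>0. \<exists>y\<in>S. n (a - y) < r)"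
proof -
  interpret Metric_space UNIV "\<lambda>x y. n (x - y)" by (rule is_norm_Metric_space[OF assms])
  show ?thesis by (auto simp: norm_topology_def metric_closure_of)
qed

lemma linear_functional_add: "linear_functional f \<Longrightarrow> f (x + y) = f x + f y"
  and linear_functional_scale: "linear_functional f \<Longrightarrow> f (c *\<^sub>C x) = c * f x"
  and linear_functional_diff: "linear_functional f \<Longrightarrow> f (x - y) = f x - f y"
  and linear_functional_sum: "linear_functional f \<Longrightarrow> f (sum g S) = (\<Sum>i\<in>S. f (g i))"
  by (simp_all add: module_hom.add module_hom.scale module_hom.diff module_hom.sum
      linear_iff_module_hom)

lemma linear_functionalI:
  assumes "\<And>x y. f (x + y) = f x + f y" "\<And>c x. f (c *\<^sub>C x) = c * f x"
  shows "linear_functional f"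
  by unfold_locales (auto simp: assms algebra_simps)

text \<open>Continuity at 0 and rescaling give the bound; conversely the bound is applied to
  differences. Continuity of functionals is handled through this bound from here on.\<close>

lemma continuous_linear_functional_iff:
  assumes n: "is_norm n" and f: "linear_functional f"
  shows "continuous_map (norm_topology n) euclidean f \<longleftrightarrow> (\<exists>K. \<forall>x. cmod (f x) \<le> K * n x)"
proof -
  interpret Metric_space UNIV "\<lambda>x y. n (x - y)" by (rule is_norm_Metric_space[OF n])
  have iff: "continuous_map (norm_topology n) euclidean f \<longleftrightarrow>
      (\<forall>a. \<forall>\<epsilon>>0. \<exists>\<delta>>0. \<forall>x. n (a - x) < \<delta> \<longrightarrow> cmod (f a - f x) < \<epsilon>)"
    unfolding norm_topology_def mtopology_is_euclidean[symmetric]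
    by (subst metric_continuous_map[OF Met_TC.Metric_space_axioms]) (simp add: dist_norm)
  show ?thesis
  proof
    assume "continuous_map (norm_topology n) euclidean f"
    with iff obtain \<delta> where \<delta>: "\<delta> > 0" "\<And>x. n (0 - x) < \<delta> \<Longrightarrow> cmod (f 0 - f x) < 1"
      by (metis zero_less_one)
    have f0: "f 0 = 0" using linear_functional_scale[OF f, of 0 0] by simp
    have minus: "n (0 - x) = n x" for x
      using is_norm_scale[OF n, of "-1" x] by simp
    have "cmod (f x) \<le> 2 / \<delta> * n x" for x
    proof (cases "x = 0")
      case False
      then have x: "n x > 0" using is_norm_zero[OF n] is_norm_nonneg[OF n] by (metis less_le)
      \<comment> \<open>Rescales \<open>x\<close> to norm \<open>\<delta> / 2\<close>, whence the
        constant \<open>2 / \<delta>\<close>.\<close>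
      let ?c = "\<delta> / (2 * n x)"
      have "n (complex_of_real ?c *\<^sub>C x) = ?c * n x"
        unfolding is_norm_scale[OF n] norm_of_real using \<delta>(1) x by simp
      then have "n (complex_of_real ?c *\<^sub>C x) < \<delta>"
        using x \<delta>(1) by simp
      then have "cmod (f (complex_of_real ?c *\<^sub>C x)) < 1"
        using \<delta>(2)[of "complex_of_real ?c *\<^sub>C x"] minus f0 by simp
      then have "?c * cmod (f x) < 1"
        unfolding linear_functional_scale[OF f] norm_mult norm_of_real using \<delta>(1) x by simp
      then show ?thesis using \<delta>(1) x by (simp add: field_simps)
    qed (use f0 is_norm_zero[OF n, of 0] in simp)
    then show "\<exists>K. \<forall>x. cmod (f x) \<le> K * n x" by blast
  next
    assume "\<exists>K. \<forall>x. cmod (f x) \<le> K * n x"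
    then obtain K where K: "cmod (f x) \<le> K * n x" for x by blast
    \<comment> \<open>\<open>K\<close> may be zero or negative; the modified constant is positive,
      so one can divide by it when choosing \<open>\<delta>\<close>.\<close>
    have K': "cmod (f x) \<le> (\<bar>K\<bar> + 1) * n x" for x
      using K[of x] mult_right_mono[of K "\<bar>K\<bar> + 1" "n x"] is_norm_nonneg[OF n, of x] by linarith
    show "continuous_map (norm_topology n) euclidean f"
      unfolding iff
    proof (intro allI impI)
      fix a and \<epsilon> :: real assume "\<epsilon> > 0"
      show "\<exists>\<delta>>0. \<forall>x. n (a - x) < \<delta> \<longrightarrow> cmod (f a - f x) < \<epsilon>"
      proof (intro exI[of _ "\<epsilon> / (\<bar>K\<bar> + 1)"] conjI allI impI)
        fix x assume "n (a - x) < \<epsilon> / (\<bar>K\<bar> + 1)"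
        then have "(\<bar>K\<bar> + 1) * n (a - x) < \<epsilon>" by (simp add: field_simps)
        then show "cmod (f a - f x) < \<epsilon>"
          using K'[of "a - x"] by (simp add: linear_functional_diff[OF f])
      qed (use \<open>\<epsilon> > 0\<close> in simp)
    qed
  qed
qed

lemma bounded_operatorD:
  assumes "bounded_operator n L"
  obtains K where "\<And>x. n (L x) \<le> K * n x" "clinear L"
  using assms by (auto simp: bounded_operator_def)

section \<open>Sums in quasi *-algebras\<close>

lemma antilinear_add: "antilinear f \<Longrightarrow> f (x + y) = f x + f y"
  and antilinear_scale: "antilinear f \<Longrightarrow> f (c *\<^sub>C x) = cnj c *\<^sub>C f x"
  by (simp_all add: antilinear_def)

lemma antilinear_sum:
  assumes "antilinear f"
  shows "f (sum g S) = (\<Sum>i\<in>S. f (g i))"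
proof -
  have "f 0 = 0" using antilinear_scale[OF assms, of 0 0] by simp
  then show ?thesis
    by (induction S rule: infinite_finite_induct) (simp_all add: antilinear_add[OF assms])
qed

lemma clinear_sum:
  assumes "clinear f"
  shows "f (sum g S) = (\<Sum>i\<in>S. f (g i))"
  using assms by (simp add: module_hom.sum linear_iff_module_hom)

lemma clinear_diff:
  assumes "clinear f"
  shows "f (x - y) = f x - f y"
  using assms by (simp add: module_hom.diff linear_iff_module_hom)

lemma core_bilinear_zero:
  assumes "core_bilinear X m" "cvs.subspace X"
  shows "m a 0 = 0" "m 0 a = 0"
  using core_bilinearD(5)[OF assms(1) cvs.subspace_0[OF assms(2)], of a 0]
    core_bilinearD(6)[OF assms(1) cvs.subspace_0[OF assms(2)], of 0 a] by simp_all

text \<open>Products are constrained only when one factor lies in the core, so there are two rules: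
  here the sum stands in the unrestricted factor, in the next lemma it stands in the core
  factor.\<close>

lemma core_bilinear_sum_outer:
  assumes m: "core_bilinear X m" and "x \<in> X"
  shows "m (\<Sum>i\<in>S. g i) x = (\<Sum>i\<in>S. m (g i) x)" "m x (\<Sum>i\<in>S. g i) = (\<Sum>i\<in>S. m x (g i))"
  using assms clinear_sum[of "\<lambda>a. m a x" g S] clinear_sum[of "m x" g S]
  by (auto simp: core_bilinear_def)

lemma core_bilinear_sum_core:
  assumes m: "core_bilinear X m" and X: "cvs.subspace X" and g: "\<And>i. i \<in> S \<Longrightarrow> g i \<in> X"
  shows "m a (\<Sum>i\<in>S. g i) = (\<Sum>i\<in>S. m a (g i))" "m (\<Sum>i\<in>S. g i) a = (\<Sum>i\<in>S. m (g i) a)"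
  using g
  by (induction S rule: infinite_finite_induct)
    (simp_all add: core_bilinear_zero[OF m X] core_bilinearD[OF m] cvs.subspace_sum[OF X])

context quasi_star_algebra
begin

text \<open>Evaluate \<open>(e\<^sup>\<star> \<cdot> e)\<^sup>\<star>\<close> in two ways: the unit
  law inside gives \<open>e\<close>, antimultiplicativity gives
  \<open>e\<^sup>\<star> \<cdot> e\<close>, which is \<open>e\<^sup>\<star>\<close>.\<close>

lemma unit_star:
  assumes "\<And>a. a \<cdot> e = a" "\<And>a. e \<cdot> a = a" "e \<in> core A"
  shows "e\<^sup>\<star> = e"
  using star_mult_right[of e "e\<^sup>\<star>"] assms star_star by simp

text \<open>Brings the square of a linear combination into the shape of the quadratic form in
  \<open>positive_kernel\<close>.\<close>

lemma star_mult_combination: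
  fixes c :: "'i \<Rightarrow> complex"
  assumes x: "\<And>i. i \<in> S \<Longrightarrow> x i \<in> core A"
  shows "(\<Sum>j\<in>S. c j *\<^sub>C x j)\<^sup>\<star> \<cdot> (\<Sum>i\<in>S. c i *\<^sub>C x i) =
    (\<Sum>i\<in>S. \<Sum>j\<in>S. (c i * cnj (c j)) *\<^sub>C ((x j)\<^sup>\<star> \<cdot> x i))"
proof -
  note sub = cvs.subspace_scale[OF core_subspace] and bil = core_bilinearD[OF mult_bilinear]
  have "(\<Sum>j\<in>S. c j *\<^sub>C x j)\<^sup>\<star> \<cdot> (\<Sum>i\<in>S. c i *\<^sub>C x i) =
      (\<Sum>i\<in>S. (\<Sum>j\<in>S. cnj (c j) *\<^sub>C (x j)\<^sup>\<star>) \<cdot> (c i *\<^sub>C x i))"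
    unfolding antilinear_sum[OF star_antilinear] antilinear_scale[OF star_antilinear]
    by (rule core_bilinear_sum_core(1)[OF mult_bilinear core_subspace]) (simp add: x sub)
  also have "\<dots> = (\<Sum>i\<in>S. \<Sum>j\<in>S. (c i * cnj (c j)) *\<^sub>C ((x j)\<^sup>\<star> \<cdot> x i))"
    by (intro sum.cong refl)
      (simp add: core_bilinear_sum_outer(1)[OF mult_bilinear] x sub bil cvs.scale_sum_right)
  finally show ?thesis .
qed

end


section \<open>Units, and the kernels of representable functionals\<close>

definition quasi_unit :: "('a::complex_vector, 'm) normed_quasi_star_scheme \<Rightarrow> 'a"
  where "quasi_unit A = (SOME e. e \<in> core A \<and> (\<forall>a. a \<cdot>\<^bsub>A\<^esub> e = a \<and> e \<cdot>\<^bsub>A\<^esub> a = a) \<and> qnorm A e = 1)"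

lemma representableD:
  assumes "representable A \<omega>"
  shows "linear_functional \<omega>"
    and "x \<in> core A \<Longrightarrow> 0 \<le> \<omega> (x\<^sup>\<star>\<^bsub>A\<^esub> \<cdot>\<^bsub>A\<^esub> x)"
    and "x \<in> core A \<Longrightarrow> y \<in> core A \<Longrightarrow>
      \<omega> (y\<^sup>\<star>\<^bsub>A\<^esub> \<cdot>\<^bsub>A\<^esub> a\<^sup>\<star>\<^bsub>A\<^esub> \<cdot>\<^bsub>A\<^esub> x) = cnj (\<omega> (x\<^sup>\<star>\<^bsub>A\<^esub> \<cdot>\<^bsub>A\<^esub> a \<cdot>\<^bsub>A\<^esub> y))"
    and "\<exists>\<gamma>>0. \<forall>x\<in>core A. cmod (\<omega> (a\<^sup>\<star>\<^bsub>A\<^esub> \<cdot>\<^bsub>A\<^esub> x)) \<le> \<gamma> * sqrt (Re (\<omega> (x\<^sup>\<star>\<^bsub>A\<^esub> \<cdot>\<^bsub>A\<^esub> x)))"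
  using assms unfolding representable_def by blast+

context normed_quasi_star_algebra
begin

lemma quasi_unit:
  "quasi_unit A \<in> core A" "a \<cdot> quasi_unit A = a" "quasi_unit A \<cdot> a = a" "qnorm A (quasi_unit A) = 1"
  using someI_ex[OF unit[unfolded Bex_def]] unfolding quasi_unit_def by blast+

lemma quasi_unit_star: "(quasi_unit A)\<^sup>\<star> = quasi_unit A"
  by (rule unit_star) (simp_all add: quasi_unit)

lemma quasi_unit_nonzero: "quasi_unit A \<noteq> 0"
  using quasi_unit(4) is_norm_zero[OF norm, of "quasi_unit A"] by auto

text \<open>The unit is its own square \<open>e\<^sup>\<star> \<cdot> e\<close>. Sufficiency
  therefore provides a continuous representable functional that is positive at the unit.\<close>

lemma quasi_unit_in_positive_cone: "quasi_unit A \<in> positive_cone A"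
proof -
  have "quasi_unit A = (\<Sum>k=1..(1::nat). (quasi_unit A)\<^sup>\<star> \<cdot> quasi_unit A)"
    by (simp add: quasi_unit quasi_unit_star)
  then show ?thesis
    unfolding positive_cone_def
    using quasi_unit(1) is_norm_zero[OF norm, of 0]
    by (intro in_closure_norm_topology[OF norm, THEN iffD2] allI impI bexI[of _ "quasi_unit A"]
        CollectI exI[of _ 1] exI[of _ "\<lambda>_. quasi_unit A"]) auto
qed

text \<open>Condition (L.2) with the unit in the middle.\<close>

lemma representable_hermitian:
  assumes "representable A \<omega>" "x \<in> core A" "y \<in> core A"
  shows "\<omega> (y\<^sup>\<star> \<cdot> x) = cnj (\<omega> (x\<^sup>\<star> \<cdot> y))"
  using representableD(3)[OF assms, of "quasi_unit A"] by (simp add: quasi_unit quasi_unit_star)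

lemma representable_combination:
  assumes "representable A \<omega>" "\<And>i. i \<in> S \<Longrightarrow> x i \<in> core A"
  shows "\<omega> ((\<Sum>i\<in>S. c i *\<^sub>C x i)\<^sup>\<star> \<cdot> (\<Sum>i\<in>S. c i *\<^sub>C x i)) =
    (\<Sum>i\<in>S. \<Sum>j\<in>S. c i * cnj (c j) * \<omega> ((x j)\<^sup>\<star> \<cdot> x i))"
  using representableD(1)[OF assms(1)] assms(2)
  by (simp add: star_mult_combination linear_functional_sum linear_functional_scale)

lemma combination_core:
  assumes "\<And>i. i \<in> S \<Longrightarrow> x i \<in> core A"
  shows "(\<Sum>i\<in>S. c i *\<^sub>C x i) \<in> core A"
  using assms by (intro cvs.subspace_sum cvs.subspace_scale core_subspace)

lemma mult_combination:
  assumes "linear_functional \<omega>" "\<And>i. i \<in> S \<Longrightarrow> x i \<in> core A"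
  shows "\<omega> (a \<cdot> (\<Sum>i\<in>S. c i *\<^sub>C x i)) = (\<Sum>i\<in>S. c i * \<omega> (a \<cdot> x i))"
  using assms cvs.subspace_scale[OF core_subspace]
  by (simp add: core_bilinear_sum_core[OF mult_bilinear core_subspace]
      core_bilinearD[OF mult_bilinear] linear_functional_sum linear_functional_scale)

text \<open>The quadratic form at \<open>c\<close> is
  \<open>\<omega> (v\<^sup>\<star> \<cdot> v)\<close> for the combination \<open>v\<close> of the
  \<open>x i\<close> with coefficients \<open>c i\<close>, so (L.1) applies.\<close>

lemma representable_kernel:
  assumes "representable A \<omega>" "\<And>i. i \<in> S \<Longrightarrow> x i \<in> core A"
  shows "positive_kernel S (\<lambda>i j. \<omega> ((x j)\<^sup>\<star> \<cdot> x i))"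
proof (rule positive_kernelI)
  show "\<omega> ((x i)\<^sup>\<star> \<cdot> x j) = cnj (\<omega> ((x j)\<^sup>\<star> \<cdot> x i))" if "i \<in> S" "j \<in> S" for i j
    using that assms by (intro representable_hermitian)
  show "0 \<le> (\<Sum>i\<in>S. \<Sum>j\<in>S. c i * cnj (c j) * \<omega> ((x j)\<^sup>\<star> \<cdot> x i))" for c
    using representableD(2)[OF assms(1) combination_core[of S x c, OF assms(2)]]
    by (simp add: representable_combination[OF assms])
qed

text \<open>Turns an estimate of the type (L.3) into positivity of a matrix, to which the Schur
  product theorem can be applied. For the combination \<open>v\<close> with coefficients
  \<open>c i\<close> the quadratic form is
  \<open>\<gamma>\<^sup>2 * \<omega> (v\<^sup>\<star> \<cdot> v)\<close> minus the squared modulus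
  of \<open>\<omega> (a \<cdot> v)\<close>.\<close>

lemma dominated_kernel:
  assumes \<omega>: "representable A \<omega>" and x: "\<And>i. i \<in> S \<Longrightarrow> x i \<in> core A"
    and dom: "\<And>x. x \<in> core A \<Longrightarrow> cmod (\<omega> (a \<cdot> x)) \<le> \<gamma> * sqrt (Re (\<omega> (x\<^sup>\<star> \<cdot> x)))"
  shows "positive_kernel S
    (\<lambda>i j. of_real (\<gamma>\<^sup>2) * \<omega> ((x j)\<^sup>\<star> \<cdot> x i) - \<omega> (a \<cdot> x i) * cnj (\<omega> (a \<cdot> x j)))"
proof (rule positive_kernelI)
  fix i j assume ij: "i \<in> S" "j \<in> S"
  have "\<omega> ((x i)\<^sup>\<star> \<cdot> x j) = cnj (\<omega> ((x j)\<^sup>\<star> \<cdot> x i))"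
    using ij x by (intro representable_hermitian[OF \<omega>])
  then show "of_real (\<gamma>\<^sup>2) * \<omega> ((x i)\<^sup>\<star> \<cdot> x j) - \<omega> (a \<cdot> x j) * cnj (\<omega> (a \<cdot> x i)) =
      cnj (of_real (\<gamma>\<^sup>2) * \<omega> ((x j)\<^sup>\<star> \<cdot> x i) - \<omega> (a \<cdot> x i) * cnj (\<omega> (a \<cdot> x j)))"
    by simp
next
  fix c
  define v where "v = (\<Sum>i\<in>S. c i *\<^sub>C x i)"
  have v: "v \<in> core A" unfolding v_def by (rule combination_core[OF x])
  have vv: "\<omega> (v\<^sup>\<star> \<cdot> v) = (\<Sum>i\<in>S. \<Sum>j\<in>S. c i * cnj (c j) * \<omega> ((x j)\<^sup>\<star> \<cdot> x i))"
    by (simp add: v_def representable_combination[OF \<omega>] x)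
  have av: "\<omega> (a \<cdot> v) = (\<Sum>i\<in>S. c i * \<omega> (a \<cdot> x i))"
    by (simp add: v_def mult_combination[OF representableD(1)[OF \<omega>]] x)
  have nonneg: "0 \<le> \<omega> (v\<^sup>\<star> \<cdot> v)" by (rule representableD(2)[OF \<omega> v])
  have "(cmod (\<omega> (a \<cdot> v)))\<^sup>2 \<le> (\<gamma> * sqrt (Re (\<omega> (v\<^sup>\<star> \<cdot> v))))\<^sup>2"
    by (rule power_mono[OF dom[OF v]]) simp
  also have "\<dots> = \<gamma>\<^sup>2 * Re (\<omega> (v\<^sup>\<star> \<cdot> v))"
    using nonneg by (simp add: power_mult_distrib less_eq_complex_def)
  finally have "0 \<le> of_real (\<gamma>\<^sup>2) * \<omega> (v\<^sup>\<star> \<cdot> v) - \<omega> (a \<cdot> v) * cnj (\<omega> (a \<cdot> v))"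
    using nonneg unfolding complex_norm_square[symmetric]
    by (simp add: less_eq_complex_def Re_power2)
  also have "\<dots> = (\<Sum>i\<in>S. \<Sum>j\<in>S. c i * cnj (c j) *
      (of_real (\<gamma>\<^sup>2) * \<omega> ((x j)\<^sup>\<star> \<cdot> x i) - \<omega> (a \<cdot> x i) * cnj (\<omega> (a \<cdot> x j))))"
    unfolding vv av cnj_sum sum_product
    unfolding sum_distrib_left
    by (simp add: sum_subtractf right_diff_distrib mult_ac)
  finally show "0 \<le> \<dots>" .
qed

end

section \<open>Tensor products\<close>

text \<open>The assumptions are invariant under exchanging the factors, so that every result about
  \<open>A\<close> also holds for \<open>B\<close>.\<close>

locale quasi_star_tensor_product =
  A: normed_quasi_star_algebra A + B: normed_quasi_star_algebra B
  for A :: "('a::complex_vector, 'm) normed_quasi_star_scheme"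
    and B :: "('b::complex_vector, 'l) normed_quasi_star_scheme" +
  fixes T :: "('t::complex_vector, 'k) normed_quasi_star_scheme"
    and tens :: "'a \<Rightarrow> 'b \<Rightarrow> 't" (infixr \<open>\<odot>\<close> 72)
  assumes tens_left: "clinear (\<lambda>a. a \<odot> b)" and tens_right: "clinear (\<lambda>b. a \<odot> b)"
    and tens_induct: "\<lbrakk>\<And>s t. P s \<Longrightarrow> P t \<Longrightarrow> P (s + t); \<And>a b. P (a \<odot> b)\<rbrakk> \<Longrightarrow> P t"
    and core_T: "core T = cvs.span {x \<odot> y | x y. x \<in> core A \<and> y \<in> core B}"
    and T_bilinear: "core_bilinear (core T) (qmult T)"
    and mult_right: "\<lbrakk>x \<in> core A; y \<in> core B\<rbrakk> \<Longrightarrow>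
      (a \<odot> b) \<cdot>\<^bsub>T\<^esub> (x \<odot> y) = (a \<cdot>\<^bsub>A\<^esub> x) \<odot> (b \<cdot>\<^bsub>B\<^esub> y)"
    and mult_left: "\<lbrakk>x \<in> core A; y \<in> core B\<rbrakk> \<Longrightarrow>
      (x \<odot> y) \<cdot>\<^bsub>T\<^esub> (a \<odot> b) = (x \<cdot>\<^bsub>A\<^esub> a) \<odot> (y \<cdot>\<^bsub>B\<^esub> b)"
    and T_star_antilinear: "antilinear (qstar T)"
    and T_star: "(a \<odot> b)\<^sup>\<star>\<^bsub>T\<^esub> = a\<^sup>\<star>\<^bsub>A\<^esub> \<odot> b\<^sup>\<star>\<^bsub>B\<^esub>"
    and T_norm: "is_norm (qnorm T)"
    and cross: "qnorm T (a \<odot> b) = qnorm A a * qnorm B b"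
    and uniform: "\<lbrakk>bounded_operator (qnorm A) T1; bounded_operator (qnorm B) T2\<rbrakk> \<Longrightarrow>
      \<exists>L. bounded_operator (qnorm T) L \<and> (\<forall>a b. L (a \<odot> b) = T1 a \<odot> T2 b)"
begin

lemmas tens_simps = clinear_add[OF tens_left] clinear_add[OF tens_right]
  clinear_scale[OF tens_left] clinear_scale[OF tens_right]

lemma T_subspace: "cvs.subspace (core T)"
  by (simp add: core_T)

lemma tens_core: "\<lbrakk>x \<in> core A; y \<in> core B\<rbrakk> \<Longrightarrow> x \<odot> y \<in> core T"
  unfolding core_T by (rule cvs.span_base) blast

text \<open>Scalars are absorbed into the first factor. The families lie in the cores at every
  index, also beyond \<open>m\<close>, which spares later sums any side condition on the index; the
  units are the default values.\<close>

lemma core_T_cases: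
  assumes "z \<in> core T"
  obtains m :: nat and x y where "\<And>i. x i \<in> core A" "\<And>i. y i \<in> core B" "z = (\<Sum>i<m. x i \<odot> y i)"
proof -
  have "\<exists>(m::nat) x y. (\<forall>i. x i \<in> core A \<and> y i \<in> core B) \<and> z = (\<Sum>i<m. x i \<odot> y i)"
    using assms unfolding core_T
  proof (induction rule: cvs.span_induct_alt)
    case base
    show ?case
      using A.quasi_unit(1) B.quasi_unit(1)
      by (intro exI[of _ 0] exI[of _ "\<lambda>_. quasi_unit A"] exI[of _ "\<lambda>_. quasi_unit B"]) simp
  next
    case (step c g t)
    obtain u v where g: "g = u \<odot> v" "u \<in> core A" "v \<in> core B" using step by blast
    obtain m :: nat and x y where t: "\<forall>i. x i \<in> core A \<and> y i \<in> core B" "t = (\<Sum>i<m. x i \<odot> y i)"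
      using step by blast
    show ?case
      by (rule exI[of _ "Suc m"], rule exI[of _ "x(m := c *\<^sub>C u)"], rule exI[of _ "y(m := v)"])
        (use g t cvs.subspace_scale[OF A.core_subspace] in \<open>simp add: tens_simps add.commute\<close>)
  qed
  then show ?thesis using that by blast
qed

lemma T_star_sum: "(\<Sum>i\<in>S. x i \<odot> y i)\<^sup>\<star>\<^bsub>T\<^esub> = (\<Sum>i\<in>S. (x i)\<^sup>\<star>\<^bsub>A\<^esub> \<odot> (y i)\<^sup>\<star>\<^bsub>B\<^esub>)"
  by (simp add: antilinear_sum[OF T_star_antilinear] T_star)

lemma T_core_star: "z \<in> core T \<Longrightarrow> z\<^sup>\<star>\<^bsub>T\<^esub> \<in> core T"
  by (erule core_T_cases)
    (simp add: T_star_sum cvs.subspace_sum[OF T_subspace] tens_core A.core_star B.core_star)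

lemmas T_sum_core = core_bilinear_sum_core[OF T_bilinear T_subspace]
  and T_sum_outer = core_bilinear_sum_outer[OF T_bilinear]

lemma T_star_mult:
  assumes "\<And>i. x i \<in> core A" "\<And>i. y i \<in> core B"
  shows "(\<Sum>i\<in>S. x i \<odot> y i)\<^sup>\<star>\<^bsub>T\<^esub> \<cdot>\<^bsub>T\<^esub> (\<Sum>i\<in>S. x i \<odot> y i) =
    (\<Sum>i\<in>S. \<Sum>j\<in>S. ((x j)\<^sup>\<star>\<^bsub>A\<^esub> \<cdot>\<^bsub>A\<^esub> x i) \<odot> ((y j)\<^sup>\<star>\<^bsub>B\<^esub> \<cdot>\<^bsub>B\<^esub> y i))"
  by (simp add: T_star_sum T_sum_core(1) T_sum_outer(1) tens_core mult_right assms)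

subsection \<open>Product functionals\<close>

text \<open>The Schur product of the kernel of \<open>\<omega>\<close> with the kernel that expresses the bound on
  \<open>\<rho> (b \<cdot> _)\<close>.\<close>

lemma slice_bound:
  assumes \<omega>: "representable A \<omega>" and \<rho>: "representable B \<rho>"
    and \<Omega>: "linear_functional \<Omega>" "\<And>a b. \<Omega> (a \<odot> b) = \<omega> a * \<rho> b"
    and dom: "\<And>y. y \<in> core B \<Longrightarrow> cmod (\<rho> (b \<cdot>\<^bsub>B\<^esub> y)) \<le> \<gamma> * sqrt (Re (\<rho> (y\<^sup>\<star>\<^bsub>B\<^esub> \<cdot>\<^bsub>B\<^esub> y)))"
    and xy: "\<And>i. x i \<in> core A" "\<And>i. y i \<in> core B"
    and w: "w = (\<Sum>i<m. \<rho> (b \<cdot>\<^bsub>B\<^esub> y i) *\<^sub>C x i)" and z: "z = (\<Sum>i<(m::nat). x i \<odot> y i)"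
  shows "\<omega> (w\<^sup>\<star>\<^bsub>A\<^esub> \<cdot>\<^bsub>A\<^esub> w) \<le> of_real (\<gamma>\<^sup>2) * \<Omega> (z\<^sup>\<star>\<^bsub>T\<^esub> \<cdot>\<^bsub>T\<^esub> z)"
proof -
  have "0 \<le> (\<Sum>i<m. \<Sum>j<m. (of_real (\<gamma>\<^sup>2) * \<rho> ((y j)\<^sup>\<star>\<^bsub>B\<^esub> \<cdot>\<^bsub>B\<^esub> y i) -
      \<rho> (b \<cdot>\<^bsub>B\<^esub> y i) * cnj (\<rho> (b \<cdot>\<^bsub>B\<^esub> y j))) * \<omega> ((x j)\<^sup>\<star>\<^bsub>A\<^esub> \<cdot>\<^bsub>A\<^esub> x i))"
    by (intro schur_product_sum_nonneg B.dominated_kernel A.representable_kernel finite_lessThan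
        \<omega> \<rho> dom xy)
  \<comment> \<open>The two terms of the first factor separate. One sums to \<open>\<Omega>\<close>
    of the square of \<open>z\<close>, since \<open>\<Omega>\<close> factorises on elementary
    tensors; the other sums to \<open>\<omega>\<close> of the square of \<open>w\<close>, whose
    coefficients are the numbers \<open>\<rho> (b \<cdot> y i)\<close>.\<close>
  also have "\<dots> = of_real (\<gamma>\<^sup>2) * \<Omega> (z\<^sup>\<star>\<^bsub>T\<^esub> \<cdot>\<^bsub>T\<^esub> z) - \<omega> (w\<^sup>\<star>\<^bsub>A\<^esub> \<cdot>\<^bsub>A\<^esub> w)"
    by (simp add: w z T_star_mult A.representable_combination[OF \<omega>] xy
        linear_functional_sum[OF \<Omega>(1)] \<Omega>(2) left_diff_distrib right_diff_distrib sum_subtractf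
        sum_distrib_left mult_ac)
  finally show ?thesis by simp
qed

text \<open>The value is the sum of the entries of the Schur product of the two Gram
  kernels.\<close>

lemma product_functional_nonneg:
  assumes \<omega>: "representable A \<omega>" and \<rho>: "representable B \<rho>"
    and \<Omega>: "linear_functional \<Omega>" "\<And>a b. \<Omega> (a \<odot> b) = \<omega> a * \<rho> b"
    and "z \<in> core T"
  shows "0 \<le> \<Omega> (z\<^sup>\<star>\<^bsub>T\<^esub> \<cdot>\<^bsub>T\<^esub> z)"
  using \<open>z \<in> core T\<close>
proof (rule core_T_cases)
  fix m :: nat and x y
  assume xy: "\<And>i. x i \<in> core A" "\<And>i. y i \<in> core B" and z: "z = (\<Sum>i<m. x i \<odot> y i)"
  have "0 \<le> (\<Sum>i<m. \<Sum>j<m. \<omega> ((x j)\<^sup>\<star>\<^bsub>A\<^esub> \<cdot>\<^bsub>A\<^esub> x i) * \<rho> ((y j)\<^sup>\<star>\<^bsub>B\<^esub> \<cdot>\<^bsub>B\<^esub> y i))"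
    by (intro schur_product_sum_nonneg A.representable_kernel B.representable_kernel
        finite_lessThan \<omega> \<rho> xy)
  also have "\<dots> = \<Omega> (z\<^sup>\<star>\<^bsub>T\<^esub> \<cdot>\<^bsub>T\<^esub> z)"
    by (simp add: z T_star_mult xy linear_functional_sum[OF \<Omega>(1)] \<Omega>(2))
  finally show ?thesis .
qed

text \<open>Both sides are additive in \<open>t\<close>, and \<open>u\<close>, \<open>v\<close> are
  finite sums of elementary tensors. This reduces the claim to elementary tensors, where it is (L.2)
  for \<open>\<omega>\<close> times (L.2) for \<open>\<rho>\<close>.\<close>

lemma product_functional_hermitian:
  assumes \<omega>: "representable A \<omega>" and \<rho>: "representable B \<rho>"
    and \<Omega>: "linear_functional \<Omega>" "\<And>a b. \<Omega> (a \<odot> b) = \<omega> a * \<rho> b"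
    and "u \<in> core T" "v \<in> core T"
  shows "\<Omega> (v\<^sup>\<star>\<^bsub>T\<^esub> \<cdot>\<^bsub>T\<^esub> t\<^sup>\<star>\<^bsub>T\<^esub> \<cdot>\<^bsub>T\<^esub> u) = cnj (\<Omega> (u\<^sup>\<star>\<^bsub>T\<^esub> \<cdot>\<^bsub>T\<^esub> t \<cdot>\<^bsub>T\<^esub> v))"
proof -
  note bil = core_bilinearD[OF T_bilinear]
  obtain m :: nat and x y where xy: "\<And>i. x i \<in> core A" "\<And>i. y i \<in> core B"
    and u: "u = (\<Sum>i<m. x i \<odot> y i)"
    using \<open>u \<in> core T\<close> by (rule core_T_cases) blast
  obtain l :: nat and x' y' where xy': "\<And>i. x' i \<in> core A" "\<And>i. y' i \<in> core B"
    and v: "v = (\<Sum>i<l. x' i \<odot> y' i)"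
    using \<open>v \<in> core T\<close> by (rule core_T_cases) blast
  show ?thesis
  proof (induction t rule: tens_induct)
    case (1 s t)
    then show ?case
      using assms(5,6) by (simp add: antilinear_add[OF T_star_antilinear] bil T_core_star
          linear_functional_add[OF \<Omega>(1)])
  next
    case (2 a b)
    have vu: "v\<^sup>\<star>\<^bsub>T\<^esub> \<cdot>\<^bsub>T\<^esub> (a \<odot> b)\<^sup>\<star>\<^bsub>T\<^esub> \<cdot>\<^bsub>T\<^esub> u = (\<Sum>i<m. \<Sum>j<l.
        ((x' j)\<^sup>\<star>\<^bsub>A\<^esub> \<cdot>\<^bsub>A\<^esub> a\<^sup>\<star>\<^bsub>A\<^esub> \<cdot>\<^bsub>A\<^esub> x i) \<odot> ((y' j)\<^sup>\<star>\<^bsub>B\<^esub> \<cdot>\<^bsub>B\<^esub> b\<^sup>\<star>\<^bsub>B\<^esub> \<cdot>\<^bsub>B\<^esub> y i))"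
      unfolding u v T_star_sum T_star
      by (simp add: T_sum_core T_sum_outer(1) tens_core A.core_star B.core_star xy xy' mult_left mult_right)
    have "u\<^sup>\<star>\<^bsub>T\<^esub> \<cdot>\<^bsub>T\<^esub> (a \<odot> b) \<cdot>\<^bsub>T\<^esub> v = (\<Sum>j<l. \<Sum>i<m.
        ((x i)\<^sup>\<star>\<^bsub>A\<^esub> \<cdot>\<^bsub>A\<^esub> a \<cdot>\<^bsub>A\<^esub> x' j) \<odot> ((y i)\<^sup>\<star>\<^bsub>B\<^esub> \<cdot>\<^bsub>B\<^esub> b \<cdot>\<^bsub>B\<^esub> y' j))"
      unfolding u v T_star_sum T_star
      by (simp add: T_sum_core T_sum_outer(1) tens_core A.core_star B.core_star xy xy' mult_left mult_right)
    also have "\<dots> = (\<Sum>i<m. \<Sum>j<l.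
        ((x i)\<^sup>\<star>\<^bsub>A\<^esub> \<cdot>\<^bsub>A\<^esub> a \<cdot>\<^bsub>A\<^esub> x' j) \<odot> ((y i)\<^sup>\<star>\<^bsub>B\<^esub> \<cdot>\<^bsub>B\<^esub> b \<cdot>\<^bsub>B\<^esub> y' j))"
      by (rule sum.swap)
    finally have uv: "u\<^sup>\<star>\<^bsub>T\<^esub> \<cdot>\<^bsub>T\<^esub> (a \<odot> b) \<cdot>\<^bsub>T\<^esub> v = \<dots>" .
    show ?case
      unfolding vu uv
      by (simp add: linear_functional_sum[OF \<Omega>(1)] \<Omega>(2) representableD(3)[OF \<omega> xy(1) xy'(1)]
          representableD(3)[OF \<rho> xy(2) xy'(2)])
  qed
qed

text \<open>For a sum of two tensors the constants add. For \<open>a \<odot> b\<close> the left side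
  is \<open>\<omega> (a\<^sup>\<star> \<cdot> w)\<close>, where \<open>w\<close> is the slice of
  \<open>z\<close> along \<open>\<rho> (b\<^sup>\<star> \<cdot> _)\<close>. Applying (L.3) for
  \<open>\<omega>\<close> at \<open>w\<close> and then \<open>slice_bound\<close> multiplies the
  constants.\<close>

lemma product_functional_bound:
  assumes \<omega>: "representable A \<omega>" and \<rho>: "representable B \<rho>"
    and \<Omega>: "linear_functional \<Omega>" "\<And>a b. \<Omega> (a \<odot> b) = \<omega> a * \<rho> b"
  shows "\<exists>\<gamma>>0. \<forall>z\<in>core T.
    cmod (\<Omega> (t\<^sup>\<star>\<^bsub>T\<^esub> \<cdot>\<^bsub>T\<^esub> z)) \<le> \<gamma> * sqrt (Re (\<Omega> (z\<^sup>\<star>\<^bsub>T\<^esub> \<cdot>\<^bsub>T\<^esub> z)))"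
proof (induction t rule: tens_induct)
  case (1 s t)
  then obtain \<gamma> \<delta> where "\<gamma> > 0" "\<delta> > 0"
    and *: "\<And>z. z \<in> core T \<Longrightarrow> cmod (\<Omega> (s\<^sup>\<star>\<^bsub>T\<^esub> \<cdot>\<^bsub>T\<^esub> z)) \<le> \<gamma> * sqrt (Re (\<Omega> (z\<^sup>\<star>\<^bsub>T\<^esub> \<cdot>\<^bsub>T\<^esub> z)))"
      "\<And>z. z \<in> core T \<Longrightarrow> cmod (\<Omega> (t\<^sup>\<star>\<^bsub>T\<^esub> \<cdot>\<^bsub>T\<^esub> z)) \<le> \<delta> * sqrt (Re (\<Omega> (z\<^sup>\<star>\<^bsub>T\<^esub> \<cdot>\<^bsub>T\<^esub> z)))"
    by blast
  show ?case
  proof (intro exI[of _ "\<gamma> + \<delta>"] conjI ballI)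
    fix z assume z: "z \<in> core T"
    show "cmod (\<Omega> ((s + t)\<^sup>\<star>\<^bsub>T\<^esub> \<cdot>\<^bsub>T\<^esub> z)) \<le> (\<gamma> + \<delta>) * sqrt (Re (\<Omega> (z\<^sup>\<star>\<^bsub>T\<^esub> \<cdot>\<^bsub>T\<^esub> z)))"
      using norm_triangle_ineq[of "\<Omega> (s\<^sup>\<star>\<^bsub>T\<^esub> \<cdot>\<^bsub>T\<^esub> z)" "\<Omega> (t\<^sup>\<star>\<^bsub>T\<^esub> \<cdot>\<^bsub>T\<^esub> z)"] *[OF z] z
      by (simp add: antilinear_add[OF T_star_antilinear] core_bilinearD[OF T_bilinear]
          linear_functional_add[OF \<Omega>(1)] distrib_right)
  qed (use \<open>\<gamma> > 0\<close> \<open>\<delta> > 0\<close> in simp)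
next
  case (2 a b)
  obtain \<gamma> where \<gamma>: "\<gamma> > 0"
    "\<And>x. x \<in> core A \<Longrightarrow> cmod (\<omega> (a\<^sup>\<star>\<^bsub>A\<^esub> \<cdot>\<^bsub>A\<^esub> x)) \<le> \<gamma> * sqrt (Re (\<omega> (x\<^sup>\<star>\<^bsub>A\<^esub> \<cdot>\<^bsub>A\<^esub> x)))"
    using representableD(4)[OF \<omega>] by blast
  obtain \<delta> where \<delta>: "\<delta> > 0"
    "\<And>y. y \<in> core B \<Longrightarrow> cmod (\<rho> (b\<^sup>\<star>\<^bsub>B\<^esub> \<cdot>\<^bsub>B\<^esub> y)) \<le> \<delta> * sqrt (Re (\<rho> (y\<^sup>\<star>\<^bsub>B\<^esub> \<cdot>\<^bsub>B\<^esub> y)))"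
    using representableD(4)[OF \<rho>] by blast
  show ?case
  proof (intro exI[of _ "\<gamma> * \<delta>"] conjI ballI)
    fix z assume "z \<in> core T"
    then obtain m :: nat and x y where xy: "\<And>i. x i \<in> core A" "\<And>i. y i \<in> core B"
      and z: "z = (\<Sum>i<m. x i \<odot> y i)"
      by (rule core_T_cases) blast
    define w where "w = (\<Sum>i<m. \<rho> (b\<^sup>\<star>\<^bsub>B\<^esub> \<cdot>\<^bsub>B\<^esub> y i) *\<^sub>C x i)"
    have w: "w \<in> core A" unfolding w_def by (rule A.combination_core[OF xy(1)])
    have "\<Omega> ((a \<odot> b)\<^sup>\<star>\<^bsub>T\<^esub> \<cdot>\<^bsub>T\<^esub> z) = \<omega> (a\<^sup>\<star>\<^bsub>A\<^esub> \<cdot>\<^bsub>A\<^esub> w)"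
      by (simp add: z w_def A.mult_combination[OF representableD(1)[OF \<omega>]] T_star T_sum_core(1) tens_core mult_right xy linear_functional_sum[OF \<Omega>(1)] \<Omega>(2)
          mult.commute)
    then have "cmod (\<Omega> ((a \<odot> b)\<^sup>\<star>\<^bsub>T\<^esub> \<cdot>\<^bsub>T\<^esub> z)) \<le> \<gamma> * sqrt (Re (\<omega> (w\<^sup>\<star>\<^bsub>A\<^esub> \<cdot>\<^bsub>A\<^esub> w)))"
      using \<gamma>(2)[OF w] by simp
    also have "Re (\<omega> (w\<^sup>\<star>\<^bsub>A\<^esub> \<cdot>\<^bsub>A\<^esub> w)) \<le> \<delta>\<^sup>2 * Re (\<Omega> (z\<^sup>\<star>\<^bsub>T\<^esub> \<cdot>\<^bsub>T\<^esub> z))"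
      using slice_bound[OF \<omega> \<rho> \<Omega> \<delta>(2) xy w_def z] by (simp add: less_eq_complex_def Re_power2)
    then have "\<gamma> * sqrt (Re (\<omega> (w\<^sup>\<star>\<^bsub>A\<^esub> \<cdot>\<^bsub>A\<^esub> w))) \<le> \<gamma> * sqrt (\<delta>\<^sup>2 * Re (\<Omega> (z\<^sup>\<star>\<^bsub>T\<^esub> \<cdot>\<^bsub>T\<^esub> z)))"
      using \<gamma>(1) by simp
    also have "\<dots> = \<gamma> * \<delta> * sqrt (Re (\<Omega> (z\<^sup>\<star>\<^bsub>T\<^esub> \<cdot>\<^bsub>T\<^esub> z)))"
      using \<delta>(1) by (simp add: real_sqrt_mult)
    finally show "cmod (\<Omega> ((a \<odot> b)\<^sup>\<star>\<^bsub>T\<^esub> \<cdot>\<^bsub>T\<^esub> z)) \<le> \<gamma> * \<delta> * sqrt (Re (\<Omega> (z\<^sup>\<star>\<^bsub>T\<^esub> \<cdot>\<^bsub>T\<^esub> z)))" .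
  qed (use \<gamma>(1) \<delta>(1) in simp)
qed

lemma product_functional_representable:
  assumes "representable A \<omega>" "representable B \<rho>"
    and "linear_functional \<Omega>" "\<And>a b. \<Omega> (a \<odot> b) = \<omega> a * \<rho> b"
  shows "representable T \<Omega>"
  unfolding representable_def
  by (intro conjI ballI allI assms(3) product_functional_nonneg[OF assms]
      product_functional_hermitian[OF assms] product_functional_bound[OF assms])

subsection \<open>Slice maps\<close>

text \<open>The cross-norm property and the norm one of the unit make
  \<open>a \<mapsto> a \<odot> e\<close> an isometry.\<close>

lemma tens_unit_inject: "a \<odot> quasi_unit B = a' \<odot> quasi_unit B \<longleftrightarrow> a = a'"
proof
  assume "a \<odot> quasi_unit B = a' \<odot> quasi_unit B"
  then have "qnorm T ((a - a') \<odot> quasi_unit B) = 0"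
    using is_norm_zero[OF T_norm, of 0] by (simp add: clinear_diff[OF tens_left])
  then show "a = a'"
    by (simp add: cross B.quasi_unit is_norm_zero[OF A.norm])
qed simp

lemma tens_unit_nonzero: "a \<noteq> 0 \<Longrightarrow> a \<odot> quasi_unit B \<noteq> 0"
  using tens_unit_inject[of a 0] clinear_diff[OF tens_left, of 0 0] by simp

text \<open>Uniformity is applied to the identity and the rank one operator
  \<open>b \<mapsto> \<rho> b *\<^sub>C e\<close>. The resulting bounded operator \<open>L\<close>
  takes its values in the isometric copy of \<open>A\<close> formed by the tensors
  \<open>a \<odot> e\<close>, and \<open>S\<close> reads off the first factor.\<close>

lemma slice_map:
  assumes \<rho>: "linear_functional \<rho>" "continuous_map (norm_topology (qnorm B)) euclidean \<rho>"
  obtains S K where "clinear S" "\<And>a b. S (a \<odot> b) = \<rho> b *\<^sub>C a"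
    "\<And>t. qnorm A (S t) \<le> K * qnorm T t"
proof -
  obtain K where K: "cmod (\<rho> b) \<le> K * qnorm B b" for b
    using \<rho> continuous_linear_functional_iff[OF B.norm] by blast
  have "bounded_operator (qnorm A) (\<lambda>a. a)"
    unfolding bounded_operator_def by (auto intro!: exI[of _ 1] clinearI)
  moreover have "bounded_operator (qnorm B) (\<lambda>b. \<rho> b *\<^sub>C quasi_unit B)"
    unfolding bounded_operator_def
    by (auto intro!: exI[of _ K] clinearI simp: linear_functional_add[OF \<rho>(1)] K
        linear_functional_scale[OF \<rho>(1)] cvs.scale_left_distrib is_norm_scale[OF B.norm] B.quasi_unit)
  ultimately obtain L where L: "bounded_operator (qnorm T) L"
    "L (a \<odot> b) = (\<rho> b *\<^sub>C a) \<odot> quasi_unit B" for a b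
    using uniform[of "\<lambda>a. a" "\<lambda>b. \<rho> b *\<^sub>C quasi_unit B"] by (auto simp: tens_simps)
  obtain M where M: "qnorm T (L t) \<le> M * qnorm T t" and L_lin: "clinear L" for t
    using bounded_operatorD[OF L(1)] by blast
  have "\<exists>u. L t = u \<odot> quasi_unit B" for t
  proof (induction t rule: tens_induct)
    case (1 s t)
    then show ?case by (auto simp: clinear_add[OF L_lin] tens_simps(1)[symmetric])
  qed (auto simp: L)
  then obtain S where S: "L t = S t \<odot> quasi_unit B" for t by metis
  show ?thesis
  proof (rule that[of S M])
    show "clinear S"
      by (rule clinearI)
        (simp_all add: tens_unit_inject[symmetric] tens_simps S[symmetric]
          clinear_add[OF L_lin] clinear_scale[OF L_lin])
    show "S (a \<odot> b) = \<rho> b *\<^sub>C a" for a b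
      using S[of "a \<odot> b"] by (simp add: L tens_unit_inject)
    show "qnorm A (S t) \<le> M * qnorm T t" for t
      using M[of t] by (simp add: S cross B.quasi_unit)
  qed
qed

text \<open>On elementary tensors the composite is \<open>\<omega> a * \<rho> b\<close>, so
  representability is that of a product functional; continuity comes from the bound on
  \<open>S\<close>.\<close>

lemma slice_functional_representable:
  assumes \<omega>: "\<omega> \<in> continuous_representables A" and \<rho>: "representable B \<rho>"
    and S: "clinear S" "\<And>a b. S (a \<odot> b) = \<rho> b *\<^sub>C a" "\<And>t. qnorm A (S t) \<le> K * qnorm T t"
  shows "(\<lambda>t. \<omega> (S t)) \<in> continuous_representables T"
proof -
  have rep: "representable A \<omega>" and "continuous_map (norm_topology (qnorm A)) euclidean \<omega>"
    using \<omega> by (auto simp: continuous_representables_def)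
  note lin = representableD(1)[OF rep]
  obtain M where M: "cmod (\<omega> a) \<le> M * qnorm A a" for a
    using \<open>continuous_map _ _ \<omega>\<close> continuous_linear_functional_iff[OF A.norm lin] by blast
  have \<Omega>: "linear_functional (\<lambda>t. \<omega> (S t))"
    by (rule linear_functionalI) (simp_all add: clinear_add[OF S(1)] clinear_scale[OF S(1)]
      linear_functional_add[OF lin] linear_functional_scale[OF lin])
  \<comment> \<open>The absolute value makes the factor nonnegative, so the bound on
    \<open>S\<close> can be multiplied by it.\<close>
  have "cmod (\<omega> (S t)) \<le> (\<bar>M\<bar> * K) * qnorm T t" for t
  proof -
    have "cmod (\<omega> (S t)) \<le> \<bar>M\<bar> * qnorm A (S t)"
      using M[of "S t"] mult_right_mono[of M "\<bar>M\<bar>" "qnorm A (S t)"] is_norm_nonneg[OF A.norm, of "S t"]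
      by linarith
    also have "\<dots> \<le> \<bar>M\<bar> * (K * qnorm T t)"
      by (rule mult_left_mono[OF S(3)]) simp
    finally show ?thesis by (simp add: mult.assoc)
  qed
  then have "continuous_map (norm_topology (qnorm T)) euclidean (\<lambda>t. \<omega> (S t))"
    using continuous_linear_functional_iff[OF T_norm \<Omega>] by blast
  moreover have "representable T (\<lambda>t. \<omega> (S t))"
    by (rule product_functional_representable[OF rep \<rho> \<Omega>])
      (simp add: S(2) linear_functional_scale[OF lin] mult.commute)
  ultimately show ?thesis by (simp add: continuous_representables_def)
qed

subsection \<open>Descent of full representability to a factor\<close>

text \<open>The embedding \<open>a \<mapsto> a \<odot> e\<close> is linear and isometric, respects
  the involution and products with a core factor, and maps core to core. Hence each condition on
  \<open>\<Omega>\<close> restricts.\<close>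

lemma restricted_functional_representable:
  assumes "\<Omega> \<in> continuous_representables T"
  shows "(\<lambda>a. \<Omega> (a \<odot> quasi_unit B)) \<in> continuous_representables A"
proof -
  have rep: "representable T \<Omega>" and "continuous_map (norm_topology (qnorm T)) euclidean \<Omega>"
    using assms by (auto simp: continuous_representables_def)
  note lin = representableD(1)[OF rep]
  obtain M where M: "cmod (\<Omega> t) \<le> M * qnorm T t" for t
    using \<open>continuous_map _ _ \<Omega>\<close> continuous_linear_functional_iff[OF T_norm lin] by blast
  have \<omega>: "linear_functional (\<lambda>a. \<Omega> (a \<odot> quasi_unit B))"
    by (rule linear_functionalI)
      (simp_all add: tens_simps linear_functional_add[OF lin] linear_functional_scale[OF lin])
  have "cmod (\<Omega> (a \<odot> quasi_unit B)) \<le> M * qnorm A a" for a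
    using M[of "a \<odot> quasi_unit B"] by (simp add: cross B.quasi_unit)
  then have "continuous_map (norm_topology (qnorm A)) euclidean (\<lambda>a. \<Omega> (a \<odot> quasi_unit B))"
    using continuous_linear_functional_iff[OF A.norm \<omega>] by blast
  moreover have "representable A (\<lambda>a. \<Omega> (a \<odot> quasi_unit B))"
  proof -
    let ?e = "quasi_unit B"
    have star: "(a \<odot> ?e)\<^sup>\<star>\<^bsub>T\<^esub> = a\<^sup>\<star>\<^bsub>A\<^esub> \<odot> ?e" for a
      by (simp add: T_star B.quasi_unit_star)
    have mult: "(a \<odot> ?e) \<cdot>\<^bsub>T\<^esub> (x \<odot> ?e) = (a \<cdot>\<^bsub>A\<^esub> x) \<odot> ?e"
      "(x \<odot> ?e) \<cdot>\<^bsub>T\<^esub> (a \<odot> ?e) = (x \<cdot>\<^bsub>A\<^esub> a) \<odot> ?e" if "x \<in> core A" for a x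
      using that by (simp_all add: mult_right mult_left B.quasi_unit)
    have core: "x \<odot> ?e \<in> core T" if "x \<in> core A" for x
      using that B.quasi_unit(1) by (rule tens_core)
    show ?thesis
      unfolding representable_def
    proof (intro conjI ballI allI \<omega>)
      fix x assume x: "x \<in> core A"
      show "0 \<le> \<Omega> ((x\<^sup>\<star>\<^bsub>A\<^esub> \<cdot>\<^bsub>A\<^esub> x) \<odot> ?e)"
        using representableD(2)[OF rep core[OF x]] x by (simp add: star mult)
      fix y a assume y: "y \<in> core A"
      show "\<Omega> ((y\<^sup>\<star>\<^bsub>A\<^esub> \<cdot>\<^bsub>A\<^esub> a\<^sup>\<star>\<^bsub>A\<^esub> \<cdot>\<^bsub>A\<^esub> x) \<odot> ?e) = cnj (\<Omega> ((x\<^sup>\<star>\<^bsub>A\<^esub> \<cdot>\<^bsub>A\<^esub> a \<cdot>\<^bsub>A\<^esub> y) \<odot> ?e))"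
        using representableD(3)[OF rep core[OF x] core[OF y], of "a \<odot> ?e"] x y A.core_star
        by (simp add: star mult)
    next
      fix a
      obtain \<gamma> where \<gamma>: "\<gamma> > 0" "\<And>z. z \<in> core T \<Longrightarrow>
          cmod (\<Omega> ((a \<odot> ?e)\<^sup>\<star>\<^bsub>T\<^esub> \<cdot>\<^bsub>T\<^esub> z)) \<le> \<gamma> * sqrt (Re (\<Omega> (z\<^sup>\<star>\<^bsub>T\<^esub> \<cdot>\<^bsub>T\<^esub> z)))"
        using representableD(4)[OF rep] by blast
      show "\<exists>\<gamma>>0. \<forall>x\<in>core A. cmod (\<Omega> ((a\<^sup>\<star>\<^bsub>A\<^esub> \<cdot>\<^bsub>A\<^esub> x) \<odot> ?e))
          \<le> \<gamma> * sqrt (Re (\<Omega> ((x\<^sup>\<star>\<^bsub>A\<^esub> \<cdot>\<^bsub>A\<^esub> x) \<odot> ?e)))"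
        using \<gamma> core by (intro exI[of _ \<gamma>]) (force simp: star mult)
    qed
  qed
  ultimately show ?thesis by (simp add: continuous_representables_def)
qed

text \<open>The same isometric embedding carries approximating sums of squares to sums of
  squares.\<close>

lemma tens_unit_positive_cone:
  assumes "a \<in> positive_cone A"
  shows "a \<odot> quasi_unit B \<in> positive_cone T"
  unfolding positive_cone_def in_closure_norm_topology[OF T_norm]
proof (intro allI impI)
  let ?e = "quasi_unit B"
  fix r :: real assume "r > 0"
  then obtain m :: nat and x where x: "\<forall>k\<in>{1..m}. x k \<in> core A"
    and r: "qnorm A (a - (\<Sum>k=1..m. (x k)\<^sup>\<star>\<^bsub>A\<^esub> \<cdot>\<^bsub>A\<^esub> x k)) < r"
    using assms unfolding positive_cone_def in_closure_norm_topology[OF A.norm] by blast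
  let ?s = "\<Sum>k=1..m. (x k \<odot> ?e)\<^sup>\<star>\<^bsub>T\<^esub> \<cdot>\<^bsub>T\<^esub> (x k \<odot> ?e)"
  have "?s = (\<Sum>k=1..m. (x k)\<^sup>\<star>\<^bsub>A\<^esub> \<cdot>\<^bsub>A\<^esub> x k) \<odot> ?e"
    using x by (simp add: clinear_sum[OF tens_left] T_star B.quasi_unit_star mult_right B.quasi_unit)
  then have "qnorm T (a \<odot> ?e - ?s) < r"
    using r by (simp add: clinear_diff[OF tens_left, symmetric] cross B.quasi_unit)
  moreover have "\<forall>k\<in>{1..m}. x k \<odot> ?e \<in> core T"
    using x tens_core B.quasi_unit(1) by blast
  ultimately show "\<exists>y\<in>{(\<Sum>k=1..n. (z k)\<^sup>\<star>\<^bsub>T\<^esub> \<cdot>\<^bsub>T\<^esub> z k) | (n::nat) z. \<forall>k\<in>{1..n}. z k \<in> core T}.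
      qnorm T (a \<odot> ?e - y) < r"
    by (intro bexI[of _ ?s] CollectI exI[of _ m] exI[of _ "\<lambda>k. x k \<odot> ?e"] conjI refl)
qed

lemma sufficient_factor:
  assumes "sufficient_representables T"
  shows "sufficient_representables A"
  unfolding sufficient_representables_def
proof (intro ballI impI)
  fix a assume a: "a \<in> positive_cone A" "a \<noteq> 0"
  have "a \<odot> quasi_unit B \<noteq> 0"
    using a(2) tens_unit_nonzero by blast
  with tens_unit_positive_cone[OF a(1)] assms obtain \<Omega>
    where "\<Omega> \<in> continuous_representables T" "\<Omega> (a \<odot> quasi_unit B) > 0"
    unfolding sufficient_representables_def by blast
  then show "\<exists>\<omega>\<in>continuous_representables A. \<omega> a > 0"
    by (intro bexI[OF _ restricted_functional_representable])
qed

text \<open>If \<open>z k\<close> converges to \<open>a \<odot> e\<close> and is Cauchy for the form of \<open>\<Omega> = \<omega> \<circ> S\<close>, then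
  \<open>S (z k)\<close> converges to \<open>\<rho> e *\<^sub>C a\<close> and is Cauchy for the form of \<open>\<omega>\<close>.\<close>

lemma closure_domain_factor:
  assumes \<omega>: "\<omega> \<in> continuous_representables A"
    and \<rho>: "\<rho> \<in> continuous_representables B" "\<rho> (quasi_unit B) \<noteq> 0"
    and dom: "\<And>\<Omega>. \<Omega> \<in> continuous_representables T \<Longrightarrow> closure_domain T \<Omega> = UNIV"
  shows "closure_domain A \<omega> = UNIV"
proof (intro set_eqI iffI UNIV_I)
  fix a
  have rep: "representable A \<omega>" "representable B \<rho>"
    and cont: "continuous_map (norm_topology (qnorm B)) euclidean \<rho>"
    using \<omega> \<rho>(1) by (auto simp: continuous_representables_def)
  note lin = representableD(1)[OF rep(1)] and \<rho>_lin = representableD(1)[OF rep(2)]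
  obtain S K where S: "clinear S" "\<And>a b. S (a \<odot> b) = \<rho> b *\<^sub>C a"
    "\<And>t. qnorm A (S t) \<le> K * qnorm T t"
    using slice_map[OF \<rho>_lin cont] by blast
  define \<Omega> where "\<Omega> t = \<omega> (S t)" for t
  have \<Omega>: "\<Omega> \<in> continuous_representables T"
    unfolding \<Omega>_def by (rule slice_functional_representable[OF \<omega> rep(2) S])
  then have \<Omega>_lin: "linear_functional \<Omega>"
    by (auto simp: continuous_representables_def representable_def)
  have \<Omega>_tens: "\<Omega> (a \<odot> b) = \<omega> a * \<rho> b" for a b
    by (simp add: \<Omega>_def S(2) linear_functional_scale[OF lin] mult.commute)
  \<comment> \<open>(L.3) for \<open>\<rho>\<close> at the unit. With \<open>b = e\<close> in
    \<open>slice_bound\<close>, the slice \<open>w\<close> becomes \<open>S z\<close>.\<close>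
  obtain \<gamma> where \<gamma>: "cmod (\<rho> (quasi_unit B \<cdot>\<^bsub>B\<^esub> y)) \<le> \<gamma> * sqrt (Re (\<rho> (y\<^sup>\<star>\<^bsub>B\<^esub> \<cdot>\<^bsub>B\<^esub> y)))"
    if "y \<in> core B" for y
    using representableD(4)[OF rep(2), of "quasi_unit B"] by (auto simp: B.quasi_unit_star)
  have S_core: "S z \<in> core A"
    and S_form: "\<omega> ((S z)\<^sup>\<star>\<^bsub>A\<^esub> \<cdot>\<^bsub>A\<^esub> S z) \<le> of_real (\<gamma>\<^sup>2) * \<Omega> (z\<^sup>\<star>\<^bsub>T\<^esub> \<cdot>\<^bsub>T\<^esub> z)" if core: "z \<in> core T" for z
  proof -
    obtain m :: nat and x y where xy: "\<And>i. x i \<in> core A" "\<And>i. y i \<in> core B"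
      and z: "z = (\<Sum>i<m. x i \<odot> y i)"
      using core by (rule core_T_cases) blast
    have w: "S z = (\<Sum>i<m. \<rho> (quasi_unit B \<cdot>\<^bsub>B\<^esub> y i) *\<^sub>C x i)"
      by (simp add: z clinear_sum[OF S(1)] S(2) B.quasi_unit)
    show "S z \<in> core A" unfolding w by (rule A.combination_core[OF xy(1)])
    show "\<omega> ((S z)\<^sup>\<star>\<^bsub>A\<^esub> \<cdot>\<^bsub>A\<^esub> S z) \<le> of_real (\<gamma>\<^sup>2) * \<Omega> (z\<^sup>\<star>\<^bsub>T\<^esub> \<cdot>\<^bsub>T\<^esub> z)"
      by (rule slice_bound[OF rep \<Omega>_lin \<Omega>_tens \<gamma> xy w z])
  qed
  obtain z where z: "\<And>k. z k \<in> core T"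
    "(\<lambda>k. qnorm T (z k - a \<odot> quasi_unit B)) \<longlonglongrightarrow> 0"
    "((\<lambda>(k, l). \<Omega> ((z k - z l)\<^sup>\<star>\<^bsub>T\<^esub> \<cdot>\<^bsub>T\<^esub> (z k - z l))) \<longlongrightarrow> 0) (sequentially \<times>\<^sub>F sequentially)"
    using dom[OF \<Omega>] unfolding closure_domain_def induced_form_def by blast
  \<comment> \<open>Normalisation: \<open>S\<close> maps \<open>a \<odot> e\<close> to
    \<open>\<rho> e *\<^sub>C a\<close>, and \<open>r\<close> removes this factor.\<close>
  define r where "r = 1 / \<rho> (quasi_unit B)"
  define x where "x k = r *\<^sub>C S (z k)" for k
  have x_core: "x k \<in> core A" for k
    unfolding x_def by (rule cvs.subspace_scale[OF A.core_subspace S_core[OF z(1)]])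
  have x_diff: "x k - a = r *\<^sub>C S (z k - a \<odot> quasi_unit B)" for k
    using \<rho>(2) by (simp add: x_def clinear_diff[OF S(1)] S(2) cvs.scale_right_diff_distrib r_def)
  have "(\<lambda>k. qnorm A (x k - a)) \<longlonglongrightarrow> 0"
  proof (rule Lim_null_comparison)
    show "\<forall>\<^sub>F k in sequentially.
        norm (qnorm A (x k - a)) \<le> cmod r * K * qnorm T (z k - a \<odot> quasi_unit B)"
      by (rule always_eventually, rule allI)
        (use S(3) is_norm_nonneg[OF A.norm] in
          \<open>simp add: x_diff is_norm_scale[OF A.norm] mult.assoc mult_left_mono\<close>)
    show "(\<lambda>k. cmod r * K * qnorm T (z k - a \<odot> quasi_unit B)) \<longlonglongrightarrow> 0"
      using tendsto_mult_left[OF z(2), of "cmod r * K"] by simp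
  qed
  moreover have "((\<lambda>(k, l). induced_form A \<omega> (x k - x l) (x k - x l)) \<longlongrightarrow> 0)
      (sequentially \<times>\<^sub>F sequentially)"
  proof (rule Lim_null_comparison)
    have "cmod (\<omega> ((x k - x l)\<^sup>\<star>\<^bsub>A\<^esub> \<cdot>\<^bsub>A\<^esub> (x k - x l)))
        \<le> (cmod r)\<^sup>2 * \<gamma>\<^sup>2 * cmod (\<Omega> ((z k - z l)\<^sup>\<star>\<^bsub>T\<^esub> \<cdot>\<^bsub>T\<^esub> (z k - z l)))" for k l
    proof -
      let ?d = "z k - z l"
      have d: "?d \<in> core T" using z(1) by (intro cvs.subspace_diff[OF T_subspace])
      \<comment> \<open>A combination with a single term pulls the scalar out of both arguments of
        the form.\<close>
      have form: "\<omega> ((x k - x l)\<^sup>\<star>\<^bsub>A\<^esub> \<cdot>\<^bsub>A\<^esub> (x k - x l)) =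
          r * cnj r * \<omega> ((S ?d)\<^sup>\<star>\<^bsub>A\<^esub> \<cdot>\<^bsub>A\<^esub> S ?d)"
        using A.representable_combination[OF rep(1), of "{()}" "\<lambda>_. S ?d" "\<lambda>_. r"] S_core[OF d]
        by (simp add: x_def clinear_diff[OF S(1)] cvs.scale_right_diff_distrib)
      have "cmod (\<omega> ((S ?d)\<^sup>\<star>\<^bsub>A\<^esub> \<cdot>\<^bsub>A\<^esub> S ?d)) = Re (\<omega> ((S ?d)\<^sup>\<star>\<^bsub>A\<^esub> \<cdot>\<^bsub>A\<^esub> S ?d))"
        using representableD(2)[OF rep(1) S_core[OF d]] by (simp add: less_eq_complex_def cmod_eq_Re)
      also have "\<dots> \<le> Re (of_real (\<gamma>\<^sup>2) * \<Omega> (?d\<^sup>\<star>\<^bsub>T\<^esub> \<cdot>\<^bsub>T\<^esub> ?d))"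
        using S_form[OF d] by (simp add: less_eq_complex_def)
      also have "\<dots> \<le> \<gamma>\<^sup>2 * cmod (\<Omega> (?d\<^sup>\<star>\<^bsub>T\<^esub> \<cdot>\<^bsub>T\<^esub> ?d))"
        using complex_Re_le_cmod[of "of_real (\<gamma>\<^sup>2) * \<Omega> (?d\<^sup>\<star>\<^bsub>T\<^esub> \<cdot>\<^bsub>T\<^esub> ?d)"]
        unfolding norm_mult norm_of_real by simp
      finally show ?thesis
        unfolding form norm_mult complex_mod_cnj power2_eq_square[of "cmod r"] mult.assoc
        by (intro mult_left_mono) simp_all
    qed
    then show "\<forall>\<^sub>F p in sequentially \<times>\<^sub>F sequentially.
        norm (case p of (k, l) \<Rightarrow> induced_form A \<omega> (x k - x l) (x k - x l)) \<le>
        (cmod r)\<^sup>2 * \<gamma>\<^sup>2 * cmod (case p of (k, l) \<Rightarrow> \<Omega> ((z k - z l)\<^sup>\<star>\<^bsub>T\<^esub> \<cdot>\<^bsub>T\<^esub> (z k - z l)))"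
      by (intro always_eventually) (auto simp: induced_form_def)
    show "((\<lambda>p. (cmod r)\<^sup>2 * \<gamma>\<^sup>2 *
        cmod (case p of (k, l) \<Rightarrow> \<Omega> ((z k - z l)\<^sup>\<star>\<^bsub>T\<^esub> \<cdot>\<^bsub>T\<^esub> (z k - z l)))) \<longlongrightarrow> 0)
        (sequentially \<times>\<^sub>F sequentially)"
      using tendsto_mult_left[OF tendsto_norm[OF z(3)], of "(cmod r)\<^sup>2 * \<gamma>\<^sup>2"] by simp
  qed
  ultimately show "a \<in> closure_domain A \<omega>"
    unfolding closure_domain_def using x_core by blast
qed

text \<open>Sufficiency of \<open>B\<close> supplies the functional \<open>\<rho>\<close> that
  defines the slices. It is obtainable from \<open>T\<close> by \<open>sufficient_factor\<close>
  with the factors exchanged, so the argument is not circular.\<close>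

lemma fully_representable_factor:
  assumes T: "fully_representable T" and B: "sufficient_representables B"
  shows "fully_representable A"
proof -
  have suff: "sufficient_representables T" using T by (simp add: fully_representable_def)
  \<comment> \<open>Rules out the degenerate case in \<open>representable_part\<close>, where the
    value is \<open>UNIV\<close> by convention. Only then does full representability of
    \<open>T\<close> say that every closure domain is the whole space.\<close>
  have "\<exists>\<Omega>\<in>continuous_representables T. \<Omega> \<noteq> (\<lambda>_. 0)"
  proof -
    have "quasi_unit A \<odot> quasi_unit B \<noteq> 0"
      by (rule tens_unit_nonzero[OF A.quasi_unit_nonzero])
    with tens_unit_positive_cone[OF A.quasi_unit_in_positive_cone] suff
    obtain \<Omega> where "\<Omega> \<in> continuous_representables T" "\<Omega> (quasi_unit A \<odot> quasi_unit B) > 0"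
      unfolding sufficient_representables_def by blast
    then show ?thesis by (intro bexI[of _ \<Omega>]) auto
  qed
  then have dom: "closure_domain T \<Omega> = UNIV" if "\<Omega> \<in> continuous_representables T" for \<Omega>
    using T that unfolding fully_representable_def representable_part_def
    by (auto split: if_splits)
  obtain \<rho> where "\<rho> \<in> continuous_representables B" "\<rho> (quasi_unit B) > 0"
    using B B.quasi_unit_in_positive_cone B.quasi_unit_nonzero
    unfolding sufficient_representables_def by blast
  then have "closure_domain A \<omega> = UNIV" if "\<omega> \<in> continuous_representables A" for \<omega>
    using closure_domain_factor[OF that _ _ dom, of \<rho>] by auto
  then show ?thesis
    using sufficient_factor[OF suff] by (simp add: fully_representable_def representable_part_def)
qed

end

section \<open>The algebraic tensor product as an instance, and the conclusion\<close>

lemma tensor_quasi_star_product: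
  fixes A :: "('a::complex_vector, 'm) normed_quasi_star_scheme"
    and B :: "('b::complex_vector, 'l) normed_quasi_star_scheme"
  assumes A: "normed_quasi_star_algebra A" and B: "normed_quasi_star_algebra B"
    and n: "uniform_cross_norm (qnorm A) (qnorm B) n"
  shows "quasi_star_tensor_product A B (tensor_quasi_star A B n) tensor_of"
proof -
  interpret A: normed_quasi_star_algebra A by fact
  interpret B: normed_quasi_star_algebra B by fact
  let ?T = "tensor_quasi_star A B n"
  \<comment> \<open>Product and involution are definite descriptions; unique existence gives access
    to their defining properties.\<close>
  have mult: "is_tensor_mult A B (qmult ?T)"
    using theI'[OF tensor_mult_unique[OF A.quasi_star_algebra_axioms B.quasi_star_algebra_axioms]]
    by (simp add: tensor_quasi_star_def)
  have star: "is_tensor_star A B (qstar ?T)"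
    using theI'[OF tensor_star_unique[OF A.quasi_star_algebra_axioms B.quasi_star_algebra_axioms]]
    by (simp add: tensor_quasi_star_def)
  have core: "core ?T = tensor_subspace (core A) (core B)" and norm: "qnorm ?T = n"
    by (simp_all add: tensor_quasi_star_def)
  have n': "is_norm n" "n (a \<otimes> b) = qnorm A a * qnorm B b" for a b
    using n by (auto simp: uniform_cross_norm_def cross_norm_def)
  show ?thesis
  proof (intro quasi_star_tensor_product.intro quasi_star_tensor_product_axioms.intro A B)
    show "clinear (\<lambda>a. a \<otimes> b)" "clinear (\<lambda>b. a \<otimes> b)" for a :: 'a and b :: 'b
      by (auto intro!: clinearI
          simp: tensor_add_left tensor_add_right tensor_scale_left tensor_scale_right)
    show "P t" if "\<And>s t. P s \<Longrightarrow> P t \<Longrightarrow> P (s + t)" "\<And>a b. P (a \<otimes> b)"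
      for P and t :: "('a, 'b) tensor"
      using that by (rule tensor_induct)
    show "core ?T = cvs.span {x \<otimes> y | x y. x \<in> core A \<and> y \<in> core B}"
      by (simp add: core tensor_subspace_def)
    show "core_bilinear (core ?T) (qmult ?T)"
      using mult by (simp add: core is_tensor_mult_def)
    show "(a \<otimes> b) \<cdot>\<^bsub>?T\<^esub> (x \<otimes> y) = (a \<cdot>\<^bsub>A\<^esub> x) \<otimes> (b \<cdot>\<^bsub>B\<^esub> y)"
      "(x \<otimes> y) \<cdot>\<^bsub>?T\<^esub> (a \<otimes> b) = (x \<cdot>\<^bsub>A\<^esub> a) \<otimes> (y \<cdot>\<^bsub>B\<^esub> b)"
      if "x \<in> core A" "y \<in> core B" for a b x y
      using mult that by (auto simp: is_tensor_mult_def)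
    show "antilinear (qstar ?T)" "(a \<otimes> b)\<^sup>\<star>\<^bsub>?T\<^esub> = a\<^sup>\<star>\<^bsub>A\<^esub> \<otimes> b\<^sup>\<star>\<^bsub>B\<^esub>" for a b
      using star by (auto simp: is_tensor_star_def)
    show "is_norm (qnorm ?T)" "qnorm ?T (a \<otimes> b) = qnorm A a * qnorm B b" for a b
      by (simp_all add: norm n')
    show "\<exists>L. bounded_operator (qnorm ?T) L \<and> (\<forall>a b. L (a \<otimes> b) = T1 a \<otimes> T2 b)"
      if "bounded_operator (qnorm A) T1" "bounded_operator (qnorm B) T2" for T1 T2
      using n that tensor_map(2)[of T1 T2] unfolding norm
      by (intro exI[of _ "tensor_map T1 T2"]) (auto simp: uniform_cross_norm_def bounded_operator_def)
  qed
qed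

text \<open>The algebra \<open>T\<close> is kept and only the arguments of \<open>tens\<close> trade
  places, so both factors are treated inside the same tensor product and no flip isomorphism
  enters.\<close>

lemma quasi_star_tensor_product_swap:
  assumes "quasi_star_tensor_product A B T tens"
  shows "quasi_star_tensor_product B A T (\<lambda>b a. tens a b)"
proof -
  interpret quasi_star_tensor_product A B T tens by fact
  show ?thesis
  proof (intro quasi_star_tensor_product.intro quasi_star_tensor_product_axioms.intro
      A.normed_quasi_star_algebra_axioms B.normed_quasi_star_algebra_axioms)
    show "P t" if "\<And>s t. P s \<Longrightarrow> P t \<Longrightarrow> P (s + t)" "\<And>b a. P (tens a b)" for P t
      using that by (rule tens_induct)
    show "core T = cvs.span {tens x y | y x. y \<in> core B \<and> x \<in> core A}"
      unfolding core_T by (rule arg_cong[of _ _ cvs.span]) blast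
    show "\<exists>L. bounded_operator (qnorm T) L \<and> (\<forall>b a. L (tens a b) = tens (T2 a) (T1 b))"
      if "bounded_operator (qnorm B) T1" "bounded_operator (qnorm A) T2" for T1 T2
      using uniform[OF that(2,1)] by blast
  qed (simp_all add: tens_left tens_right T_bilinear mult_right mult_left T_star_antilinear T_star
      T_norm cross mult.commute)
qed

theorem theorem6p14:
  fixes A :: "'a::complex_vector normed_quasi_star"
    and B :: "'b::complex_vector normed_quasi_star"
    and n :: "('a, 'b) tensor \<Rightarrow> real"
  assumes "banach_quasi_star_algebra A"
    and "banach_quasi_star_algebra B"
    and "uniform_cross_norm (qnorm A) (qnorm B) n"
    and "\<And>t. n (t\<^sup>\<star>\<^bsub>tensor_quasi_star A B n\<^esub>) = n t"
    and "fully_representable (tensor_quasi_star A B n)"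
  shows "fully_representable A \<and> fully_representable B"
proof -
  let ?T = "tensor_quasi_star A B n"
  interpret AB: quasi_star_tensor_product A B ?T tensor_of
    by (intro tensor_quasi_star_product banach_quasi_star_algebra.axioms(1) assms(1-3))
  interpret BA: quasi_star_tensor_product B A ?T "\<lambda>b a. a \<otimes> b"
    by (rule quasi_star_tensor_product_swap) unfold_locales
  \<comment> \<open>Sufficiency descends to both factors first, because the domain argument for each
    factor uses sufficiency of the other.\<close>
  have "sufficient_representables ?T"
    using assms(5) by (simp add: fully_representable_def)
  then show ?thesis
    using AB.fully_representable_factor BA.fully_representable_factor assms(5)
      AB.sufficient_factor BA.sufficient_factor by blast
qed

end
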